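(* Let $(M,\mathcal{T},\Phi)$ be a weighted triangulated closed connected surface (with arbitrary Euler characteristic) with a branch structure with orders $\beta=(\beta_1,\dots,\beta_N)^T$, let $\alpha\ge0$, and let $\overline{R}:V\to\mathbb{R}$ be a function. Suppose that $\overline{R}_i\le0$ for all $i$, that $\{\alpha\overline{R}_i\}_{1\le i\le N}$ are not identically zero, and that $\overline{R}$ is admissible and $\tanh$-admissible by circle packing metrics $\overline{r}^{\mathbb{E}}$ and $\overline{r}^{\mathbb{H}}_{\tanh}$, respectively. Then $\overline{r}^{\mathbb{E}}$ is the unique metric in $\mathbb{R}_{>0}^N$ with $B^{\mathbb{E}}_{\alpha,i}(\overline{r}^{\mathbb{E}})=\overline{R}_i$ for all $i$, and $\overline{r}^{\mathbb{H}}_{\tanh}$ is the unique metric in $\mathbb{R}_{>0}^N$ with $B^{\mathbb{H}}_{\alpha,i,\tanh}(\overline{r}^{\mathbb{H}}_{\tanh})=\overline{R}_i$ for all $i$. Moreover, the solutions to the flows $$\frac{\mathrm{d}u_i^{\mathbb{E}}}{\mathrm{d}t}=\overline{R}_ir_i^\alpha-(K_i+2\pi\beta_i)\quad\text{in }\mathbb{E}^2,\qquad \frac{\mathrm{d}u_i^{\mathbb{H}}}{\mathrm{d}t}=\overline{R}_i\tanh^\alpha\frac{r_i}{2}-(K_i+2\pi\beta_i)\quad\text{in }\mathbb{H}^2$$ exist for all time and converge exponentially fast to $\overline{r}^{\mathbb{E}}$ and $\overline{r}^{\mathbb{H}}_{\tanh}$, respectively.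
   Context: $M$ is a closed connected surface with a triangulation $\mathcal{T}=\{V,E,F\}$, $V=\{v_1,\dots,v_N\}$, and a weight $\Phi:E\to[0,\pi/2]$, $\Phi_{ij}=\Phi(e_{ij})$. A circle packing metric is a function $r=(r_1,\dots,r_N)^T:V\to(0,+\infty)$. The edge $e_{ij}$ has length $l_{ij}=\sqrt{r_i^2+r_j^2+2r_ir_j\cos\Phi_{ij}}$ in Euclidean background geometry $\mathbb{E}^2$, and $l_{ij}=\cosh^{-1}(\cosh r_i\cosh r_j+\sinh r_i\sinh r_j\cos\Phi_{ij})$ in hyperbolic background geometry $\mathbb{H}^2$; each face $\Delta_{ijk}$ is then a Euclidean (resp. hyperbolic) triangle, $\theta_i^{ijk}$ is its inner angle at $v_i$, and $K_i=2\pi-\sum_{f_{ijk}\in F}\theta_i^{ijk}$ (sum over all triangles having $v_i$ as a vertex). Coordinates: $u_i^{\mathbb{E}}=\ln r_i$ and $u_i^{\mathbb{H}}=\ln\tanh\frac{r_i}{2}$. Branch structure: a (possibly empty) set $\{(b_1,\beta_1),\dots,(b_m,\beta_m)\}$ of distinct vertices with orders $\beta_j\in\mathbb{Z}_{>0}$; write $\beta_i$ for the order at $v_i$, with $\beta_i=0$ if $v_i$ is not one of the $b_j$. It is a branch structure if each simple closed path $\Gamma=\{e_1,\dots,e_n\}$ in $\mathcal{T}$ satisfies $\sum_{j=1}^n[\pi-\Phi(e_j)]>2(l(\Gamma)+1)\pi$, where $l(\Gamma)$ is the sum of the orders of the branch points enclosed by $\Gamma$. The branched $\alpha$-curvature in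 $\mathbb{E}^2$ is $B^{\mathbb{E}}_{\alpha,i}=(K_i+2\pi\beta_i)/r_i^\alpha$ (Euclidean $K_i$); the branched $\alpha$-$\tanh$-curvature in $\mathbb{H}^2$ is $B^{\mathbb{H}}_{\alpha,i,\tanh}=(K_i+2\pi\beta_i)/\tanh^\alpha\frac{r_i}{2}$ (hyperbolic $K_i$). $\overline{R}$ is admissible in $\mathbb{E}^2$ if there is a circle packing metric $\overline{r}^{\mathbb{E}}$ with branched $\alpha$-curvature $\overline{R}$ in $\mathbb{E}^2$; it is $\tanh$-admissible in $\mathbb{H}^2$ if there is a circle packing metric $\overline{r}^{\mathbb{H}}_{\tanh}$ with branched $\alpha$-$\tanh$-curvature $\overline{R}$ in $\mathbb{H}^2$. *)

theory Defs
  imports "HOL-Analysis.Analysis"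
begin

section \<open>Triangulated closed connected surfaces\<close>

text \<open>
  A triangulation is given by its set of faces, each face being the set of its three vertices.
  The vertex set is the whole finite type \<open>'v\<close>, so that \<open>N = CARD('v)\<close> and radius vectors
  are elements of \<open>real ^ 'v\<close>.
\<close>

definition edges :: "'v set set \<Rightarrow> 'v set set" where
  "edges F = {e. card e = 2 \<and> (\<exists>f\<in>F. e \<subseteq> f)}"

text \<open>
  The third and fourth conditions say that the link of every vertex \<open>v\<close> is a cycle: the link is
  the graph with edges \<open>f - {v}\<close> for the faces \<open>f\<close> at \<open>v\<close>; it is 2-regular by the third
  condition and connected by the fourth.
\<close>

definition closed_connected_triangulated_surface :: "'v::finite set set \<Rightarrow> bool" where
  "closed_connected_triangulated_surface F \<longleftrightarrow>
     (\<forall>f\<in>F. card f = 3) \<and>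
     \<Union>F = UNIV \<and>
     (\<forall>e\<in>edges F. card {f\<in>F. e \<subseteq> f} = 2) \<and>
     (\<forall>v x y. {v, x} \<in> edges F \<and> {v, y} \<in> edges F \<longrightarrow>
        (x, y) \<in> {(p, q). p \<noteq> q \<and> p \<noteq> v \<and> q \<noteq> v \<and> {v, p, q} \<in> F}\<^sup>*) \<and>
     (\<forall>x y. (x, y) \<in> {(p, q). {p, q} \<in> edges F}\<^sup>*)"

definition weight :: "'v set set \<Rightarrow> ('v set \<Rightarrow> real) \<Rightarrow> bool" where
  "weight F \<Phi> \<longleftrightarrow> (\<forall>e\<in>edges F. 0 \<le> \<Phi> e \<and> \<Phi> e \<le> pi / 2)"

section \<open>Branch structures\<close>

text \<open>A simple closed path is given by the list of the vertices it passes through.\<close>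

definition path_edges :: "'v list \<Rightarrow> 'v set set" where
  "path_edges vs = {{vs ! k, vs ! (Suc k mod length vs)} | k. k < length vs}"

definition simple_closed_path :: "'v set set \<Rightarrow> 'v list \<Rightarrow> bool" where
  "simple_closed_path F vs \<longleftrightarrow> 3 \<le> length vs \<and> distinct vs \<and> path_edges vs \<subseteq> edges F"

text \<open>
  \<open>D\<close> is the set of faces of a closed disc with boundary the simple closed path \<open>vs\<close>.
  In a closed connected surface the second condition already forces \<open>D\<close> to be a compact connected
  surface with boundary circle \<open>vs\<close>; it is a disc iff its Euler characteristic is 1.
\<close>

definition disc_bounded_by :: "'v set set \<Rightarrow> 'v list \<Rightarrow> 'v set set \<Rightarrow> bool" where
  "disc_bounded_by F vs D \<longleftrightarrow>
     D \<subseteq> F \<and>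
     {e\<in>edges D. card {f\<in>D. e \<subseteq> f} = 1} = path_edges vs \<and>
     int (card (\<Union>D)) - int (card (edges D)) + int (card D) = 1"

text \<open>
  A vertex is enclosed by a path if it is interior to a disc bounded by that path. A path that
  bounds no disc encloses nothing. Only on the sphere can a path bound two discs; then the vertices
  on both sides count as enclosed.
\<close>

definition enclosed :: "'v set set \<Rightarrow> 'v list \<Rightarrow> 'v set" where
  "enclosed F vs = {v. \<exists>D. disc_bounded_by F vs D \<and> v \<in> \<Union>D - set vs}"

text \<open>
  Branch points with positive orders are encoded by the order function on all vertices; the branch
  points are the vertices of nonzero order.
\<close>

definition branch_structure ::
    "'v::finite set set \<Rightarrow> ('v set \<Rightarrow> real) \<Rightarrow> ('v \<Rightarrow> nat) \<Rightarrow> bool" where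
  "branch_structure F \<Phi> \<beta> \<longleftrightarrow>
     (\<forall>vs. simple_closed_path F vs \<longrightarrow>
        (\<Sum>e\<in>path_edges vs. pi - \<Phi> e) > 2 * (real (\<Sum>v\<in>enclosed F vs. \<beta> v) + 1) * pi)"

section \<open>Circle packing metrics and curvature\<close>

definition circle_packing_metric :: "real ^ 'v \<Rightarrow> bool" where
  "circle_packing_metric r \<longleftrightarrow> (\<forall>i. r $ i > 0)"

definition length_E :: "('v set \<Rightarrow> real) \<Rightarrow> real ^ 'v \<Rightarrow> 'v \<Rightarrow> 'v \<Rightarrow> real" where
  "length_E \<Phi> r i j = sqrt ((r $ i)\<^sup>2 + (r $ j)\<^sup>2 + 2 * r $ i * r $ j * cos (\<Phi> {i, j}))"

definition length_H :: "('v set \<Rightarrow> real) \<Rightarrow> real ^ 'v \<Rightarrow> 'v \<Rightarrow> 'v \<Rightarrow> real" where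
  "length_H \<Phi> r i j =
     arcosh (cosh (r $ i) * cosh (r $ j) + sinh (r $ i) * sinh (r $ j) * cos (\<Phi> {i, j}))"

text \<open>
  Inner angle at \<open>i\<close> of the triangle \<open>ijk\<close> with edge lengths \<open>l\<close>, by the Euclidean and the
  hyperbolic law of cosines.
\<close>

definition angle_E :: "('v \<Rightarrow> 'v \<Rightarrow> real) \<Rightarrow> 'v \<Rightarrow> 'v \<Rightarrow> 'v \<Rightarrow> real" where
  "angle_E l i j k = arccos (((l i j)\<^sup>2 + (l i k)\<^sup>2 - (l j k)\<^sup>2) / (2 * l i j * l i k))"

definition angle_H :: "('v \<Rightarrow> 'v \<Rightarrow> real) \<Rightarrow> 'v \<Rightarrow> 'v \<Rightarrow> 'v \<Rightarrow> real" where
  "angle_H l i j k =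
     arccos ((cosh (l i j) * cosh (l i k) - cosh (l j k)) / (sinh (l i j) * sinh (l i k)))"

text \<open>
  Faces are unordered: the inner angle at \<open>i\<close> of the face \<open>f\<close> is \<open>\<theta> i j k\<close>, where \<open>j\<close> and \<open>k\<close>
  are the other two vertices of \<open>f\<close> in either order.
\<close>

definition inner_angle :: "('v \<Rightarrow> 'v \<Rightarrow> 'v \<Rightarrow> real) \<Rightarrow> 'v set \<Rightarrow> 'v \<Rightarrow> real" where
  "inner_angle \<theta> f i = (THE a. \<exists>j k. f = {i, j, k} \<and> a = \<theta> i j k)"

definition K_E :: "'v::finite set set \<Rightarrow> ('v set \<Rightarrow> real) \<Rightarrow> real ^ 'v \<Rightarrow> 'v \<Rightarrow> real" where
  "K_E F \<Phi> r i = 2 * pi - (\<Sum>f\<in>{f\<in>F. i \<in> f}. inner_angle (angle_E (length_E \<Phi> r)) f i)"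

definition K_H :: "'v::finite set set \<Rightarrow> ('v set \<Rightarrow> real) \<Rightarrow> real ^ 'v \<Rightarrow> 'v \<Rightarrow> real" where
  "K_H F \<Phi> r i = 2 * pi - (\<Sum>f\<in>{f\<in>F. i \<in> f}. inner_angle (angle_H (length_H \<Phi> r)) f i)"

lemma length_E_commute: "length_E \<Phi> r i j = length_E \<Phi> r j i"
  by (simp add: length_E_def insert_commute algebra_simps)

lemma length_H_commute: "length_H \<Phi> r i j = length_H \<Phi> r j i"
  by (simp add: length_H_def insert_commute algebra_simps)

lemma angle_E_commute: "angle_E (length_E \<Phi> r) i j k = angle_E (length_E \<Phi> r) i k j"
  by (simp add: angle_E_def length_E_commute[of \<Phi> r j k] algebra_simps)

lemma angle_H_commute: "angle_H (length_H \<Phi> r) i j k = angle_H (length_H \<Phi> r) i k j"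
  by (simp add: angle_H_def length_H_commute[of \<Phi> r j k] algebra_simps)

lemma inner_angle_eq:
  assumes comm: "\<And>j k. \<theta> i j k = \<theta> i k j" and card3: "card {i, j, k} = 3"
  shows "inner_angle \<theta> {i, j, k} i = \<theta> i j k"
proof -
  have d: "i \<noteq> j" "i \<noteq> k" "j \<noteq> k"
    using card3 by (auto simp: card_insert_if split: if_splits)
  show ?thesis
    unfolding inner_angle_def
  proof (rule the_equality)
    show "\<exists>j' k'. {i, j, k} = {i, j', k'} \<and> \<theta> i j k = \<theta> i j' k'"
      by blast
  next
    fix a
    assume "\<exists>j' k'. {i, j, k} = {i, j', k'} \<and> a = \<theta> i j' k'"
    then obtain j' k' where e: "{i, j, k} = {i, j', k'}" and a: "a = \<theta> i j' k'"
      by blast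
    have "(j' = j \<and> k' = k) \<or> (j' = k \<and> k' = j)"
      using e d by (metis insert_iff singletonD)
    with a comm show "a = \<theta> i j k"
      by auto
  qed
qed

section \<open>Branched curvatures\<close>

definition branched_curvature_E ::
    "'v::finite set set \<Rightarrow> ('v set \<Rightarrow> real) \<Rightarrow> ('v \<Rightarrow> nat) \<Rightarrow> real \<Rightarrow> real ^ 'v \<Rightarrow> 'v \<Rightarrow> real" where
  "branched_curvature_E F \<Phi> \<beta> \<alpha> r i = (K_E F \<Phi> r i + 2 * pi * real (\<beta> i)) / (r $ i) powr \<alpha>"

definition branched_tanh_curvature_H ::
    "'v::finite set set \<Rightarrow> ('v set \<Rightarrow> real) \<Rightarrow> ('v \<Rightarrow> nat) \<Rightarrow> real \<Rightarrow> real ^ 'v \<Rightarrow> 'v \<Rightarrow> real" where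
  "branched_tanh_curvature_H F \<Phi> \<beta> \<alpha> r i =
     (K_H F \<Phi> r i + 2 * pi * real (\<beta> i)) / (tanh (r $ i / 2)) powr \<alpha>"

definition admissible_by_E ::
    "'v::finite set set \<Rightarrow> ('v set \<Rightarrow> real) \<Rightarrow> ('v \<Rightarrow> nat) \<Rightarrow> real \<Rightarrow> ('v \<Rightarrow> real) \<Rightarrow> real ^ 'v \<Rightarrow> bool" where
  "admissible_by_E F \<Phi> \<beta> \<alpha> R r \<longleftrightarrow>
     circle_packing_metric r \<and> (\<forall>i. branched_curvature_E F \<Phi> \<beta> \<alpha> r i = R i)"

definition tanh_admissible_by_H ::
    "'v::finite set set \<Rightarrow> ('v set \<Rightarrow> real) \<Rightarrow> ('v \<Rightarrow> nat) \<Rightarrow> real \<Rightarrow> ('v \<Rightarrow> real) \<Rightarrow> real ^ 'v \<Rightarrow> bool" where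
  "tanh_admissible_by_H F \<Phi> \<beta> \<alpha> R r \<longleftrightarrow>
     circle_packing_metric r \<and> (\<forall>i. branched_tanh_curvature_H F \<Phi> \<beta> \<alpha> r i = R i)"

section \<open>Flows\<close>

definition u_E :: "real \<Rightarrow> real" where
  "u_E x = ln x"

definition u_H :: "real \<Rightarrow> real" where
  "u_H x = ln (tanh (x / 2))"

text \<open>\<open>r\<close> solves the flow on the time interval \<open>I\<close>; derivatives at the endpoints are one-sided.\<close>

definition flow_solution_E ::
    "'v::finite set set \<Rightarrow> ('v set \<Rightarrow> real) \<Rightarrow> ('v \<Rightarrow> nat) \<Rightarrow> real \<Rightarrow> ('v \<Rightarrow> real) \<Rightarrow>
     real set \<Rightarrow> (real \<Rightarrow> real ^ 'v) \<Rightarrow> bool" where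
  "flow_solution_E F \<Phi> \<beta> \<alpha> R I r \<longleftrightarrow>
     (\<forall>t\<in>I. circle_packing_metric (r t) \<and>
        (\<forall>i. ((\<lambda>s. u_E (r s $ i)) has_real_derivative
              (R i * (r t $ i) powr \<alpha> - (K_E F \<Phi> (r t) i + 2 * pi * real (\<beta> i)))) (at t within I)))"

definition flow_solution_H ::
    "'v::finite set set \<Rightarrow> ('v set \<Rightarrow> real) \<Rightarrow> ('v \<Rightarrow> nat) \<Rightarrow> real \<Rightarrow> ('v \<Rightarrow> real) \<Rightarrow>
     real set \<Rightarrow> (real \<Rightarrow> real ^ 'v) \<Rightarrow> bool" where
  "flow_solution_H F \<Phi> \<beta> \<alpha> R I r \<longleftrightarrow>
     (\<forall>t\<in>I. circle_packing_metric (r t) \<and>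
        (\<forall>i. ((\<lambda>s. u_H (r s $ i)) has_real_derivative
              (R i * (tanh (r t $ i / 2)) powr \<alpha> - (K_H F \<Phi> (r t) i + 2 * pi * real (\<beta> i)))) (at t within I)))"

text \<open>
  In the following, \<open>sol I r\<close> means that \<open>r\<close> solves a given flow on the interval \<open>I\<close>. Long-time
  existence: from every initial metric there is a solution on \<open>[0,\<infinity>)\<close>, and no solution stops in
  finite time, that is, each solution on some \<open>[0,T)\<close> extends to \<open>[0,\<infinity>)\<close>.
\<close>

definition solutions_exist_for_all_time ::
    "(real set \<Rightarrow> (real \<Rightarrow> real ^ 'v) \<Rightarrow> bool) \<Rightarrow> bool" where
  "solutions_exist_for_all_time sol \<longleftrightarrow>
     (\<forall>r0. circle_packing_metric r0 \<longrightarrow> (\<exists>r. sol {0..} r \<and> r 0 = r0)) \<and>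
     (\<forall>T>0. \<forall>r. sol {0..<T} r \<longrightarrow> (\<exists>r'. sol {0..} r' \<and> (\<forall>t\<in>{0..<T}. r' t = r t)))"

definition solutions_converge_exponentially ::
    "(real set \<Rightarrow> (real \<Rightarrow> real ^ 'v::finite) \<Rightarrow> bool) \<Rightarrow> real ^ 'v \<Rightarrow> bool" where
  "solutions_converge_exponentially sol rbar \<longleftrightarrow>
     (\<forall>r. sol {0..} r \<longrightarrow>
        (\<exists>C>0. \<exists>c>0. \<forall>t\<ge>0. norm (r t - rbar) \<le> C * exp (- c * t)))"

end

theory Submission
  imports Defs "HOL-Real_Asymp.Real_Asymp"
begin

text \<open>
  In the coordinates \<open>u\<close> both flows have the form
  \<open>u\<^sub>i' = R\<^sub>i exp (\<alpha> u\<^sub>i) - (K\<^sub>i + 2 \<pi> \<beta>\<^sub>i)\<close>, because \<open>r\<^sup>\<alpha>\<close> and \<open>tanh\<^sup>\<alpha> (r / 2)\<close> are both \<open>exp (\<alpha> u)\<close>.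
  An angle \<open>\<theta>\<^sub>i\<close> increases with \<open>u\<^sub>j\<close> for \<open>j \<noteq> i\<close> and does not increase when all coordinates grow at
  unit speed. So the Jacobian of the vector field has nonnegative off-diagonal entries, positive along
  edges, and nonpositive row sums \<open>\<le> \<alpha> R\<^sub>i exp (\<alpha> u\<^sub>i)\<close>, at least one of them negative. By the maximum
  principle the sup-distance of two solutions does not grow. In hyperbolic geometry \<open>\<theta>\<^sub>i \<rightarrow> 0\<close> uniformly as
  \<open>r\<^sub>i \<rightarrow> \<infinity>\<close>, which keeps the radii bounded. On a compact set a suitably weighted sup-distance to the
  equilibrium decays exponentially, since the 1-skeleton is connected; uniqueness of the equilibrium
  follows.
\<close>

text \<open>Euclidean angles are invariant under scaling, so there the angle part of every row sum
  vanishes and \<open>\<alpha> * R i * exp (\<alpha> * u $ i)\<close> is the only source of decay;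
  it is guaranteed to be nonzero at a single vertex. Decay reaches the other vertices along edges,
  so every edge entry of the Jacobian has to be strictly positive, and this is where the branch
  condition enters. The given equilibrium \<open>e\<close> takes the place of a potential. A
  sup-norm ball about \<open>e\<close> is invariant as long as it lies in the domain of
  \<open>u\<close>. Its lower faces always do, which keeps the radii away from 0 without a separate
  estimate. Its upper faces do in Euclidean geometry, where the domain is the whole line. In
  hyperbolic geometry the domain is \<open>u < 0\<close>, with \<open>r = \<infinity>\<close> at
  \<open>u = 0\<close>, and the ball may cross 0; there a barrier built from small angles replaces
  the upper faces. A trajectory thus stays in one compact order interval, on which all constants are
  uniform.\<close>

section \<open>Cooperative flows\<close>

text \<open>Look at the first time some component touches the barrier. All components are still
  within it, so the touching index is a weighted maximum and decays at rate \<open>c\<close>. The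
  barrier decays at the smaller rate \<open>c'\<close>, so the component was above it just before, a
  contradiction. The gap between the rates makes this comparison strict.\<close>

lemma weighted_max_principle:
  fixes w w' :: "real \<Rightarrow> 'v::finite \<Rightarrow> real" and p :: "'v \<Rightarrow> real"
  assumes p: "\<And>i. p i > 0" and "K > 0" and "c' < c"
    and der: "\<And>t i. t \<in> {0..T} \<Longrightarrow> ((\<lambda>s. w s i) has_real_derivative w' t i) (at t within {0..T})"
    and init: "\<And>i. \<bar>w 0 i\<bar> < K * p i"
    and max: "\<And>t i. t \<in> {0..T} \<Longrightarrow> (\<And>j. \<bar>w t j\<bar> * p i \<le> \<bar>w t i\<bar> * p j) \<Longrightarrow>
                sgn (w t i) * w' t i \<le> - c * \<bar>w t i\<bar>"
    and t: "t \<in> {0..T}"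
  shows "\<bar>w t i\<bar> < K * p i * exp (- c' * t)"
proof (rule ccontr)
  assume neg: "\<not> ?thesis"
  define b where "b s = K * exp (- c' * s)" for s
  have b_pos: "b s > 0" for s
    using \<open>K > 0\<close> by (simp add: b_def)
  define S where "S = (\<Union>i. {s \<in> {0..T}. p i * b s \<le> \<bar>w s i\<bar>})"
  have cont: "continuous_on {0..T} (\<lambda>s. w s j)" for j
    using der by (intro DERIV_continuous_on) auto
  have contb: "continuous_on {0..T} b"
    unfolding b_def by (intro continuous_intros)
  have "closed {s \<in> {0..T}. p j * b s \<le> \<bar>w s j\<bar>}" for j
    using cont contb by (intro continuous_on_closed_Collect_le continuous_intros) auto
  then have "closed S"
    unfolding S_def by (intro closed_UN) auto
  then have "compact S"
    unfolding compact_eq_bounded_closed by (auto simp: S_def intro: bounded_subset[OF bounded_closed_interval])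
  moreover have "t \<in> S"
    using neg t by (auto simp: S_def b_def algebra_simps intro!: exI[of _ i])
  ultimately obtain t1 where t1: "t1 \<in> S" "\<And>s. s \<in> S \<Longrightarrow> t1 \<le> s"
    using compact_attains_inf[of S] by auto
  then obtain i where i: "t1 \<in> {0..T}" "p i * b t1 \<le> \<bar>w t1 i\<bar>"
    by (auto simp: S_def)
  have before: "\<bar>w s j\<bar> < p j * b s" if "0 \<le> s" "s < t1" for s j
  proof (rule ccontr)
    assume "\<not> ?thesis"
    then have "s \<in> S"
      using that i by (auto simp: S_def intro!: exI[of _ j])
    then show False
      using t1(2) that by force
  qed
  have "t1 \<noteq> 0"
    using i init[of i] by (auto simp: b_def algebra_simps)
  then have "t1 > 0"
    using i by auto
  have le: "\<bar>w t1 j\<bar> \<le> p j * b t1" for j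
  proof (rule tendsto_le)
    show "at t1 within {0..<t1} \<noteq> bot"
      using \<open>t1 > 0\<close> by (simp add: at_within_eq_bot_iff)
    show "((\<lambda>s. \<bar>w s j\<bar>) \<longlongrightarrow> \<bar>w t1 j\<bar>) (at t1 within {0..<t1})"
      using i cont[of j] unfolding continuous_on_def
      by (intro tendsto_intros tendsto_within_subset[where S = "{0..T}" and T = "{0..<t1}"]) auto
    show "((\<lambda>s. p j * b s) \<longlongrightarrow> p j * b t1) (at t1 within {0..<t1})"
      using i contb unfolding continuous_on_def
      by (intro tendsto_intros tendsto_within_subset[where S = "{0..T}" and T = "{0..<t1}"]) auto
    show "\<forall>\<^sub>F s in at t1 within {0..<t1}. \<bar>w s j\<bar> \<le> p j * b s"
      using before by (auto simp: eventually_at_filter intro!: always_eventually less_imp_le)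
  qed
  have eq: "\<bar>w t1 i\<bar> = p i * b t1"
    using i le[of i] by auto
  \<comment> \<open>The sign is frozen at \<open>t1\<close>: \<open>\<sigma> * w s i\<close> is
    differentiable, never exceeds \<open>\<bar>w s i\<bar>\<close>, and equals it at
    \<open>t1\<close>, so the absolute value need not be differentiated.\<close>
  define \<sigma> where "\<sigma> = sgn (w t1 i)"
  have \<sigma>: "\<sigma> * w t1 i = \<bar>w t1 i\<bar>" "\<bar>\<sigma>\<bar> \<le> 1"
    by (auto simp: \<sigma>_def sgn_if)
  have "\<sigma> * w' t1 i \<le> - c * \<bar>w t1 i\<bar>"
    unfolding \<sigma>_def
  proof (rule max)
    show "\<bar>w t1 j\<bar> * p i \<le> \<bar>w t1 i\<bar> * p j" for j
      using mult_right_mono[OF le[of j], of "p i"] p[of i] by (simp add: eq mult_ac)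
  qed (use i in auto)
  then have "\<sigma> * w' t1 i - p i * (- c' * b t1) \<le> - (c - c') * (p i * b t1)"
    by (simp add: eq algebra_simps)
  also have "\<dots> < 0"
    using p[of i] b_pos[of t1] \<open>c' < c\<close> by (simp add: mult_neg_pos)
  finally have neg': "\<sigma> * w' t1 i - p i * (- c' * b t1) < 0" .
  have "((\<lambda>s. \<sigma> * w s i - p i * b s) has_real_derivative (\<sigma> * w' t1 i - p i * (- c' * b t1))) (at t1 within {0..T})"
    unfolding b_def using der[OF i(1), of i]
    by (auto intro!: derivative_eq_intros)
  from has_real_derivative_neg_dec_left[OF this neg'] obtain d where d: "d > 0"
    "\<And>h. h > 0 \<Longrightarrow> t1 - h \<in> {0..T} \<Longrightarrow> h < d \<Longrightarrow>
        \<sigma> * w t1 i - p i * b t1 < \<sigma> * w (t1 - h) i - p i * b (t1 - h)"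
    by blast
  define h where "h = min (d / 2) t1"
  have h: "h > 0" "h < d" "t1 - h \<in> {0..T}" "0 \<le> t1 - h" "t1 - h < t1"
    using d(1) \<open>t1 > 0\<close> i by (auto simp: h_def min_def)
  have "\<sigma> * w (t1 - h) i \<le> \<bar>\<sigma>\<bar> * \<bar>w (t1 - h) i\<bar>"
    by (metis abs_ge_self abs_mult)
  also have "\<dots> \<le> 1 * \<bar>w (t1 - h) i\<bar>"
    using \<sigma>(2) by (intro mult_right_mono) auto
  finally have "\<sigma> * w (t1 - h) i \<le> \<bar>w (t1 - h) i\<bar>" by simp
  then show False
    using d(2)[OF h(1) h(3) h(2)] before[OF h(4,5), of i] \<sigma>(1) eq by linarith
qed

text \<open>Picard iteration on the whole half-line at once: after division by the Bielecki weight
  \<open>exp (2 * L' * t)\<close> the integral operator contracts by 1/2 in the sup norm, so no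
  local solutions have to be glued. The bound \<open>B\<close> makes the integral grow at most
  linearly, which keeps the weighted iterates bounded.\<close>

lemma lipschitz_ode_solution:
  fixes G :: "'a::euclidean_space \<Rightarrow> 'a"
  assumes lip: "\<And>x y. norm (G x - G y) \<le> L * norm (x - y)" and bd: "\<And>x. norm (G x) \<le> B"
  obtains u where "u 0 = u0"
    and "\<And>t. t \<ge> 0 \<Longrightarrow> (u has_vector_derivative G (u t)) (at t within {0..})"
proof -
  define L' where "L' = max L 1"
  have L': "L' > 0" "norm (G x - G y) \<le> L' * norm (x - y)" for x y
    using lip[of x y] mult_right_mono[of L L' "norm (x - y)"] by (auto simp: L'_def)
  have contG: "continuous_on S G" for S
  proof (rule continuous_on_subset[OF _ subset_UNIV])
    show "continuous_on UNIV G"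
      using L' by (intro lipschitz_on_continuous_on[of L'] lipschitz_onI) (auto simp: dist_norm)
  qed
  have B: "B \<ge> 0"
    using bd[of u0] norm_ge_zero[of "G u0"] by linarith
  define g where "g v s = G (u0 + exp (2 * L' * s) *\<^sub>R apply_bcontfun v s)" for v s
  define I where "I v t = integral {0..t} (g v)" for v t
  \<comment> \<open>The bounded continuous functions live on all of the real line;
    \<open>max 0 t\<close> extends the iterates constantly to negative times.\<close>
  define Tf where "Tf v t = exp (- 2 * L' * max 0 t) *\<^sub>R I v (max 0 t)" for v t
  have contg: "continuous_on S (g v)" for v S
    unfolding g_def
    by (intro continuous_on_compose2[OF contG[of UNIV]] continuous_intros
        continuous_on_subset[OF continuous_on_apply_bcontfun]) auto
  have int: "g v integrable_on {0..t}" for v t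
    using contg by (rule integrable_continuous_interval)
  have "continuous_on {..<real n} (\<lambda>t. I v (max 0 t))" for v n
    unfolding I_def
    by (intro continuous_on_compose2[OF indefinite_integral_continuous_1[OF int[of v "real n"]]] continuous_intros)
      auto
  then have "continuous_on (\<Union>n. {..<real n}) (\<lambda>t. I v (max 0 t))" for v
    by (intro continuous_on_open_UN) auto
  also have "(\<Union>n. {..<real n}) = UNIV"
    using reals_Archimedean2 by auto
  finally have contI: "continuous_on UNIV (\<lambda>t. I v (max 0 t))" for v .
  have contT: "continuous_on UNIV (Tf v)" for v
    unfolding Tf_def by (intro continuous_intros contI)
  have normI: "norm (I v t) \<le> B * t" if "t \<ge> 0" for v t
    unfolding I_def using integral_bound[of 0 t "g v" B] that contg bd by (auto simp: g_def)
  have bdT: "norm (Tf v t) \<le> B / (2 * L')" for v t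
  proof -
    define s where "s = max 0 t"
    have s: "s \<ge> 0" by (simp add: s_def)
    have "norm (Tf v t) \<le> exp (- 2 * L' * s) * (B * s)"
      unfolding Tf_def s_def[symmetric] using normI[OF s, of v] by simp
    also have "\<dots> = exp (- (2 * L' * s)) * (2 * L' * s) * (B / (2 * L'))"
      using L'(1) by simp
    also have "\<dots> \<le> 1 * (B / (2 * L'))"
    proof (rule mult_right_mono)
      have "2 * L' * s \<le> exp (2 * L' * s)"
        using exp_ge_add_one_self[of "2 * L' * s"] by linarith
      then show "exp (- (2 * L' * s)) * (2 * L' * s) \<le> 1"
        by (simp add: exp_minus field_simps)
    qed (use B L' in auto)
    finally show ?thesis by simp
  qed
  have Tb: "Tf v \<in> bcontfun" for v
    using contT bdT by (auto simp: bcontfun_def bounded_iff)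
  have contract: "dist (Bcontfun (Tf v)) (Bcontfun (Tf w)) \<le> 1/2 * dist v w" for v w
  proof (rule dist_bound)
    fix t :: real
    define s where "s = max 0 t"
    have s: "s \<ge> 0" by (simp add: s_def)
    define D where "D = dist v w"
    have "((\<lambda>r. L' * D * exp (2 * L' * r)) has_integral
             (D / 2 * exp (2 * L' * s) - D / 2 * exp (2 * L' * 0))) {0..s}"
      using s L'(1)
      by (intro fundamental_theorem_of_calculus)
        (auto simp flip: has_real_derivative_iff_has_vector_derivative intro!: derivative_eq_intros)
    note hi = this
    have "norm (integral {0..s} (\<lambda>r. g v r - g w r)) \<le> integral {0..s} (\<lambda>r. L' * D * exp (2 * L' * r))"
    proof (rule integral_norm_bound_integral)
      show "(\<lambda>r. g v r - g w r) integrable_on {0..s}"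
        by (intro integrable_diff int)
      show "(\<lambda>r. L' * D * exp (2 * L' * r)) integrable_on {0..s}"
        using hi by blast
      fix r
      have "norm (g v r - g w r) \<le> L' * norm (exp (2 * L' * r) *\<^sub>R (apply_bcontfun v r - apply_bcontfun w r))"
        unfolding g_def by (rule order_trans[OF L'(2)]) (simp add: algebra_simps)
      also have "\<dots> = L' * exp (2 * L' * r) * dist (apply_bcontfun v r) (apply_bcontfun w r)"
        by (simp add: dist_norm)
      also have "\<dots> \<le> L' * exp (2 * L' * r) * D"
        unfolding D_def using L'(1) by (intro mult_left_mono dist_bounded) auto
      finally show "norm (g v r - g w r) \<le> L' * D * exp (2 * L' * r)"
        by (simp add: mult_ac)
    qed
    also have "\<dots> = D / 2 * exp (2 * L' * s) - D / 2"
      using integral_unique[OF hi] by simp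
    also have "integral {0..s} (\<lambda>r. g v r - g w r) = I v s - I w s"
      unfolding I_def by (intro integral_diff int)
    finally have "norm (I v s - I w s) \<le> D / 2 * exp (2 * L' * s)"
      using zero_le_dist[of v w] unfolding D_def[symmetric] by linarith
    then have "norm (Tf v t - Tf w t) \<le> exp (- 2 * L' * s) * (D / 2 * exp (2 * L' * s))"
      unfolding Tf_def s_def[symmetric] by (simp flip: scaleR_diff_right)
    also have "\<dots> = D / 2"
      by (simp add: exp_minus)
    finally show "dist (apply_bcontfun (Bcontfun (Tf v)) t) (apply_bcontfun (Bcontfun (Tf w)) t) \<le> 1 / 2 * dist v w"
      by (simp add: Bcontfun_inverse Tb dist_norm D_def)
  qed
  obtain v where "Bcontfun (Tf v) = v"
    using banach_fix_type[of "1/2" "\<lambda>v. Bcontfun (Tf v)"] contract by auto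
  then have v: "apply_bcontfun v = Tf v"
    by (metis Bcontfun_inverse Tb)
  define u where "u t = u0 + exp (2 * L' * t) *\<^sub>R apply_bcontfun v t" for t
  have g: "g v = (\<lambda>s. G (u s))"
    by (auto simp: g_def u_def)
  have u: "u t = u0 + I v t" if "t \<ge> 0" for t
    using that unfolding u_def v Tf_def by (simp add: exp_minus)
  show ?thesis
  proof
    show "u 0 = u0"
      using u[of 0] by (simp add: I_def)
    fix t :: real assume t: "t \<ge> 0"
    have "(I v has_vector_derivative g v t) (at t within {0..t+1})"
      unfolding I_def using t by (intro integral_has_vector_derivative contg) auto
    moreover have "at t within {0..t+1} = at t within {0..}"
      by (rule at_within_nhd[of t "{..<t+1}"]) auto
    ultimately have "(I v has_vector_derivative g v t) (at t within {0..})"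
      by simp
    then have "((\<lambda>t. u0 + I v t) has_vector_derivative g v t) (at t within {0..})"
      by (auto intro!: derivative_eq_intros)
    then show "(u has_vector_derivative G (u t)) (at t within {0..})"
      using t u unfolding g by (auto intro: has_vector_derivative_transform[rotated 2])
  qed
qed

text \<open>After the last time at which \<open>\<phi> \<le> h\<close> the derivative is
  nonpositive, so \<open>\<phi>\<close> cannot climb. A weak inequality suffices because it is
  required in the whole region above \<open>h\<close> and not only on the level \<open>h\<close>;
  freezing a vector field provides exactly that.\<close>

lemma real_barrier_le:
  fixes \<phi> \<phi>' :: "real \<Rightarrow> real"
  assumes der: "\<And>t. t \<ge> 0 \<Longrightarrow> (\<phi> has_real_derivative \<phi>' t) (at t within {0..})"
    and init: "\<phi> 0 \<le> h" and barrier: "\<And>t. t \<ge> 0 \<Longrightarrow> \<phi> t > h \<Longrightarrow> \<phi>' t \<le> 0" and t: "t \<ge> 0"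
  shows "\<phi> t \<le> h"
proof (rule ccontr)
  assume "\<not> ?thesis"
  then have gt: "\<phi> t > h" by simp
  define S where "S = {s \<in> {0..t}. \<phi> s \<le> h}"
  have cont: "continuous_on {0..} \<phi>"
    using der by (intro DERIV_continuous_on) auto
  have "closed S"
    unfolding S_def
    by (intro continuous_on_closed_Collect_le continuous_on_subset[OF cont] continuous_intros) auto
  then have "compact S"
    unfolding compact_eq_bounded_closed
    by (auto simp: S_def intro: bounded_subset[OF bounded_closed_interval])
  moreover have "0 \<in> S"
    using init t by (auto simp: S_def)
  ultimately obtain s0 where s0: "s0 \<in> S" "\<And>s. s \<in> S \<Longrightarrow> s \<le> s0"
    using compact_attains_sup[of S] by auto
  have s0': "0 \<le> s0" "s0 < t" "\<phi> s0 \<le> h"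
    using s0(1) gt by (auto simp: S_def less_le)
  have above: "\<phi> s > h" if "s0 < s" "s \<le> t" for s
    using s0(2)[of s] that s0' by (force simp: S_def)
  have "\<phi> t \<le> \<phi> s0"
  proof (rule DERIV_nonpos_imp_decreasing_open[of s0 t \<phi>])
    show "s0 \<le> t" using s0' by simp
    show "continuous_on {s0..t} \<phi>"
      using s0' by (intro continuous_on_subset[OF cont]) auto
    fix s assume s: "s0 < s" "s < t"
    have "(\<phi> has_real_derivative \<phi>' s) (at s)"
      using der[of s] s s0' by (simp add: at_within_interior[of s "{0..}"] interior_Ici)
    then show "\<exists>y. (\<phi> has_real_derivative y) (at s) \<and> y \<le> 0"
      using barrier[of s] above[of s] s s0' by auto
  qed
  then show False
    using s0' gt by simp
qed

text \<open>Replacing each \<open>w j\<close> by its extreme value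
  \<open>\<bar>w i\<bar> / p i * p j\<close> can only increase the off-diagonal terms, and it leaves
  the diagonal term unchanged, whatever the sign of \<open>A i\<close>. Control of the row on the
  single vector \<open>p\<close> therefore suffices.\<close>

lemma cooperative_row_at_weighted_max:
  fixes A w p :: "'v::finite \<Rightarrow> real"
  assumes A: "\<And>j. j \<noteq> i \<Longrightarrow> A j \<ge> 0" and p: "p i > 0"
    and max: "\<And>j. \<bar>w j\<bar> * p i \<le> \<bar>w i\<bar> * p j"
  shows "sgn (w i) * (\<Sum>j\<in>UNIV. A j * w j) \<le> \<bar>w i\<bar> / p i * (\<Sum>j\<in>UNIV. A j * p j)"
  unfolding sum_distrib_left
proof (rule sum_mono)
  fix j
  show "sgn (w i) * (A j * w j) \<le> \<bar>w i\<bar> / p i * (A j * p j)"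
  proof (cases "j = i")
    case True
    then show ?thesis
      using p by (simp add: abs_sgn)
  next
    case False
    have "sgn (w i) * w j \<le> \<bar>w j\<bar>"
      by (auto simp: sgn_if)
    also have "\<dots> \<le> \<bar>w i\<bar> / p i * p j"
      using max[of j] p by (simp add: field_simps)
    finally have "A j * (sgn (w i) * w j) \<le> A j * (\<bar>w i\<bar> / p i * p j)"
      using A[OF False] by (rule mult_left_mono)
    then show ?thesis
      by (simp add: mult_ac)
  qed
qed

section \<open>Cooperative vector fields on a downward closed cube\<close>

definition cube :: "real set \<Rightarrow> (real ^ 'v) set" where
  "cube J = {u. \<forall>i. u $ i \<in> J}"

text \<open>\<open>J\<close> will be the whole line or the negative half-line. \<open>E\<close>
  holds the pairs with a strictly positive entry and \<open>i0\<close> is the row with a strictly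
  negative sum. Derivatives are assumed along lines only, which is what the mean value theorem
  consumes.\<close>

locale cooperative_flow =
  fixes f :: "'v::finite \<Rightarrow> real ^ 'v \<Rightarrow> real"
    and a :: "'v \<Rightarrow> 'v \<Rightarrow> real ^ 'v \<Rightarrow> real"
    and J :: "real set" and E :: "('v \<times> 'v) set" and i0 :: 'v and e :: "real ^ 'v"
  assumes J_down: "x \<in> J \<Longrightarrow> y \<le> x \<Longrightarrow> y \<in> J"
    and der: "u + s *\<^sub>R h \<in> cube J \<Longrightarrow>
      ((\<lambda>s. f i (u + s *\<^sub>R h)) has_real_derivative (\<Sum>j\<in>UNIV. a i j (u + s *\<^sub>R h) * h $ j)) (at s)"
    and cont: "continuous_on (cube J) (a i j)"
    and offdiag: "u \<in> cube J \<Longrightarrow> i \<noteq> j \<Longrightarrow> a i j u \<ge> 0"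
    and edge: "u \<in> cube J \<Longrightarrow> (i, j) \<in> E \<Longrightarrow> i \<noteq> j \<and> a i j u > 0"
    and connected: "(i, j) \<in> E\<^sup>*"
    and row_sum: "u \<in> cube J \<Longrightarrow> (\<Sum>j\<in>UNIV. a i j u) \<le> 0"
    and row_sum_i0: "u \<in> cube J \<Longrightarrow> (\<Sum>j\<in>UNIV. a i0 j u) < 0"
    and equilibrium: "e \<in> cube J" "f i e = 0"
    and upper_barrier_or_UNIV: "J = UNIV \<or> (\<forall>u0\<in>cube J. \<exists>hi\<in>cube J. (\<forall>i. u0 $ i \<le> hi $ i \<and> e $ i \<le> hi $ i) \<and>
      (\<forall>u\<in>cube J. \<forall>i. (\<forall>j. u $ j \<le> hi $ j) \<and> u $ i = hi $ i \<longrightarrow> f i u \<le> 0))"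
begin

definition solution :: "real set \<Rightarrow> (real \<Rightarrow> real ^ 'v) \<Rightarrow> bool" where
  "solution I u \<longleftrightarrow> (\<forall>t\<in>I. u t \<in> cube J \<and>
     (\<forall>i. ((\<lambda>s. u s $ i) has_real_derivative f i (u t)) (at t within I)))"

definition rect :: "real ^ 'v \<Rightarrow> real ^ 'v \<Rightarrow> (real ^ 'v) set" where
  "rect lo hi = {u. \<forall>i. lo $ i \<le> u $ i \<and> u $ i \<le> hi $ i}"

lemma rect_subset_cube: "hi \<in> cube J \<Longrightarrow> rect lo hi \<subseteq> cube J"
  using J_down by (auto simp: cube_def rect_def)

lemma compact_box: "compact (rect lo hi)"
proof -
  have "rect lo hi = cbox lo hi"
    by (auto simp: rect_def mem_box_cart)
  then show ?thesis by simp
qed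

lemma rect_segment:
  assumes "u \<in> rect lo hi" "v \<in> rect lo hi" "0 \<le> s" "s \<le> 1"
  shows "v + s *\<^sub>R (u - v) \<in> rect lo hi"
proof -
  have "rect lo hi = cbox lo hi"
    by (auto simp: rect_def mem_box_cart)
  then have "convex (rect lo hi)" by simp
  then have "(1 - s) *\<^sub>R v + s *\<^sub>R u \<in> rect lo hi"
    using assms by (intro convexD) auto
  then show ?thesis by (simp add: algebra_simps)
qed

lemma mean_value_box:
  assumes "hi \<in> cube J" "u \<in> rect lo hi" "v \<in> rect lo hi"
  obtains \<xi> where "\<xi> \<in> rect lo hi" "\<xi> \<in> cube J"
    and "f i u - f i v = (\<Sum>j\<in>UNIV. a i j \<xi> * (u $ j - v $ j))"
proof -
  let ?g = "\<lambda>s. f i (v + s *\<^sub>R (u - v))"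
  have in_D: "v + s *\<^sub>R (u - v) \<in> cube J" if "0 \<le> s" "s \<le> 1" for s
    using rect_segment[OF assms(2,3) that] rect_subset_cube[OF assms(1)] by auto
  obtain s where s: "0 < s" "s < 1" "?g 1 - ?g 0 =
      (1 - 0) * (\<Sum>j\<in>UNIV. a i j (v + s *\<^sub>R (u - v)) * (u - v) $ j)"
    using MVT2[of 0 1 ?g, OF _ der[OF in_D]] by auto
  show ?thesis
    by (rule that[of "v + s *\<^sub>R (u - v)"]) (use s in_D rect_segment[OF assms(2,3)] in auto)
qed

lemma mean_value:
  assumes "u \<in> cube J" "v \<in> cube J"
  obtains \<xi> where "\<xi> \<in> cube J" and "f i u - f i v = (\<Sum>j\<in>UNIV. a i j \<xi> * (u $ j - v $ j))"
proof -
  define lo hi :: "real ^ 'v" where "lo = (\<chi> i. min (u $ i) (v $ i))" and "hi = (\<chi> i. max (u $ i) (v $ i))"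
  have "hi \<in> cube J" "u \<in> rect lo hi" "v \<in> rect lo hi"
    using assms by (auto simp: cube_def rect_def lo_def hi_def max_def)
  from mean_value_box[OF this] that show ?thesis by metis
qed

text \<open>Since \<open>f\<close> vanishes at \<open>e\<close>, a mean value row applied to
  \<open>u - e\<close> gives \<open>f i u\<close>. Raising every signed difference to
  \<open>M\<close> costs nothing off the diagonal, and the row sum then has the right sign. Use
  \<open>\<sigma> = 1\<close> for upper and \<open>\<sigma> = -1\<close> for lower faces; the bound
  is one-sided, so a lower face may be combined with any upper corner.\<close>

lemma sign_at_extremum:
  assumes u: "u \<in> cube J" and M: "M \<ge> 0" "\<And>j. \<sigma> * (u $ j - e $ j) \<le> M" "\<sigma> * (u $ i - e $ i) = M"
  shows "\<sigma> * f i u \<le> 0"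
proof -
  obtain \<xi> where \<xi>: "\<xi> \<in> cube J" "f i u - f i e = (\<Sum>j\<in>UNIV. a i j \<xi> * (u $ j - e $ j))"
    using mean_value[OF u equilibrium(1)] by blast
  have "\<sigma> * f i u = (\<Sum>j\<in>UNIV. a i j \<xi> * (\<sigma> * (u $ j - e $ j)))"
    using \<xi>(2) equilibrium(2) by (simp add: sum_distrib_left mult_ac)
  also have "\<dots> \<le> (\<Sum>j\<in>UNIV. a i j \<xi> * M)"
  proof (rule sum_mono)
    fix j
    show "a i j \<xi> * (\<sigma> * (u $ j - e $ j)) \<le> a i j \<xi> * M"
      using M offdiag[OF \<xi>(1), of i j] by (cases "j = i") (simp_all add: mult_left_mono)
  qed
  also have "\<dots> = M * (\<Sum>j\<in>UNIV. a i j \<xi>)"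
    by (simp add: sum_distrib_left mult_ac)
  also have "\<dots> \<le> 0"
    using M(1) row_sum[OF \<xi>(1)] by (rule mult_nonneg_nonpos)
  finally show ?thesis .
qed

lemma upper_barrier:
  assumes "u0 \<in> cube J"
  obtains hi where "hi \<in> cube J" "\<And>i. u0 $ i \<le> hi $ i" "\<And>i. e $ i \<le> hi $ i"
    and "\<And>u i. u \<in> cube J \<Longrightarrow> (\<And>j. u $ j \<le> hi $ j) \<Longrightarrow> u $ i = hi $ i \<Longrightarrow> f i u \<le> 0"
  using upper_barrier_or_UNIV
proof
  assume J: "J = UNIV"
  define hi :: "real ^ 'v" where "hi = (\<chi> i. e $ i + norm (u0 - e))"
  show thesis
  proof (rule that)
    show "hi \<in> cube J" using J by (simp add: cube_def)
    show "u0 $ i \<le> hi $ i" "e $ i \<le> hi $ i" for i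
      using component_le_norm_cart[of "u0 - e" i] by (auto simp: hi_def)
    fix u i assume "u \<in> cube J" "\<And>j. u $ j \<le> hi $ j" "u $ i = hi $ i"
    then show "f i u \<le> 0"
      using sign_at_extremum[of u "norm (u0 - e)" 1 i] by (auto simp: hi_def algebra_simps)
  qed
qed (use assms that in metis)

lemma solution_unique:
  assumes u: "solution {0..T} u" and v: "solution {0..T} v" and init: "u 0 = v 0" and t: "t \<in> {0..T}"
  shows "u t = v t"
proof -
  \<comment> \<open>With unit weights the row sums give decay rate \<open>c = 0\<close>. The rate -1
    supplies the strict gap at the price of a factor \<open>exp t\<close>, which the arbitrary
    constant \<open>K\<close> absorbs below.\<close>
  have small: "\<bar>u t $ i - v t $ i\<bar> < K * 1 * exp (- (-1) * t)" if "K > 0" for K i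
  proof (rule weighted_max_principle[where c = 0 and w = "\<lambda>t i. u t $ i - v t $ i" and
          w' = "\<lambda>t i. f i (u t) - f i (v t)" and T = T and p = "\<lambda>_. 1"])
    fix t i assume t: "t \<in> {0..T}"
    then show "((\<lambda>s. u s $ i - v s $ i) has_real_derivative f i (u t) - f i (v t)) (at t within {0..T})"
      using u v by (auto simp: solution_def intro!: derivative_intros)
    have "u t \<in> cube J" "v t \<in> cube J"
      using u v t by (auto simp: solution_def)
    then obtain \<xi> where \<xi>: "\<xi> \<in> cube J" "f i (u t) - f i (v t) = (\<Sum>j\<in>UNIV. a i j \<xi> * (u t $ j - v t $ j))"
      using mean_value by blast
    assume "\<And>j. \<bar>u t $ j - v t $ j\<bar> * 1 \<le> \<bar>u t $ i - v t $ i\<bar> * 1"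
    then have "sgn (u t $ i - v t $ i) * (f i (u t) - f i (v t))
        \<le> \<bar>u t $ i - v t $ i\<bar> / 1 * (\<Sum>j\<in>UNIV. a i j \<xi> * 1)"
      unfolding \<xi>(2) using offdiag[OF \<xi>(1)]
      by (intro cooperative_row_at_weighted_max[where p = "\<lambda>_. 1" and w = "\<lambda>j. u t $ j - v t $ j"]) auto
    also have "\<dots> \<le> 0"
      using row_sum[OF \<xi>(1), of i] by (auto intro!: mult_nonneg_nonpos)
    finally show "sgn (u t $ i - v t $ i) * (f i (u t) - f i (v t)) \<le> - 0 * \<bar>u t $ i - v t $ i\<bar>"
      by simp
  qed (use that init t in auto)
  have "\<bar>u t $ i - v t $ i\<bar> \<le> 0 + \<epsilon>" if "\<epsilon> > 0" for \<epsilon> i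
    using small[of "\<epsilon> * exp (- t)" i] that by (simp add: mult.assoc flip: exp_add)
  then have "u t $ i = v t $ i" for i
    by (metis abs_le_zero_iff eq_iff_diff_eq_0 field_le_epsilon)
  then show ?thesis
    by (simp add: vec_eq_iff)
qed

section \<open>Trapping, global existence and extension\<close>

lemma bounded_derivatives:
  assumes "hi \<in> cube J"
  obtains \<Lambda> where "\<Lambda> > 0" "\<And>i j u. u \<in> rect lo hi \<Longrightarrow> \<bar>a i j u\<bar> \<le> \<Lambda>"
proof -
  have "\<exists>B. \<forall>u\<in>rect lo hi. \<bar>a i j u\<bar> \<le> B" for i j
  proof -
    have "compact (a i j ` rect lo hi)"
      using continuous_on_subset[OF cont rect_subset_cube[OF assms]] compact_box
      by (rule compact_continuous_image)
    then show ?thesis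
      using compact_imp_bounded by (fastforce simp: bounded_iff)
  qed
  then obtain B where B: "\<And>i j u. u \<in> rect lo hi \<Longrightarrow> \<bar>a i j u\<bar> \<le> B i j"
    by metis
  define \<Lambda> where "\<Lambda> = 1 + (\<Sum>i\<in>UNIV. \<Sum>j\<in>UNIV. \<bar>B i j\<bar>)"
  have "B i j \<le> \<Lambda>" for i j
  proof -
    have "\<bar>B i j\<bar> \<le> (\<Sum>j\<in>UNIV. \<bar>B i j\<bar>)"
      by (rule member_le_sum) auto
    also have "\<dots> \<le> (\<Sum>i\<in>UNIV. \<Sum>j\<in>UNIV. \<bar>B i j\<bar>)"
      by (rule member_le_sum[of i UNIV "\<lambda>i. \<Sum>j\<in>UNIV. \<bar>B i j\<bar>"]) (auto intro: sum_nonneg)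
    finally show ?thesis by (simp add: \<Lambda>_def)
  qed
  moreover have "\<Lambda> > 0"
    unfolding \<Lambda>_def by (intro add_pos_nonneg sum_nonneg) auto
  ultimately show ?thesis
    using that B by (meson order_trans)
qed

text \<open>
  The vector field is frozen outside an order interval on whose faces it points inwards. The frozen
  field is bounded and globally Lipschitz, and its solutions never leave the interval.
\<close>

lemma trapped_solution:
  assumes u0: "u0 \<in> cube J"
  obtains lo hi u where "hi \<in> cube J" "e \<in> rect lo hi" "u 0 = u0" "solution {0..} u"
    and "\<And>t. t \<ge> 0 \<Longrightarrow> u t \<in> rect lo hi"
proof -
  obtain hi where hi: "hi \<in> cube J" "\<And>i. u0 $ i \<le> hi $ i" "\<And>i. e $ i \<le> hi $ i"
    and up: "\<And>u i. u \<in> cube J \<Longrightarrow> (\<And>j. u $ j \<le> hi $ j) \<Longrightarrow> u $ i = hi $ i \<Longrightarrow> f i u \<le> 0"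
    using upper_barrier[OF u0] by metis
  \<comment> \<open>A ball about \<open>e\<close> that contains \<open>u0\<close>. Its lower corner
    lies in the domain because \<open>J\<close> is closed downwards; only the upper corner comes
    from a barrier.\<close>
  define M where "M = norm (u0 - e)"
  define lo :: "real ^ 'v" where "lo = (\<chi> i. e $ i - M)"
  have u0_box: "u0 \<in> rect lo hi"
    unfolding rect_def lo_def M_def using hi component_le_norm_cart[of "u0 - e"]
    by (auto simp: abs_le_iff algebra_simps)
  have e_box: "e \<in> rect lo hi"
    using hi by (auto simp: rect_def lo_def M_def)
  have down: "f i u \<ge> 0" if u: "u \<in> rect lo hi" "u $ i = lo $ i" for u i
    using sign_at_extremum[of u M "-1" i] u rect_subset_cube[OF hi(1)]
    by (auto simp: rect_def lo_def M_def algebra_simps)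
  \<comment> \<open>Coordinatewise projection onto the interval. It is 1-Lipschitz, and if a
    coordinate lies outside, the projected point lies on the corresponding face, where the sign of
    \<open>f i\<close> is known.\<close>
  define cl :: "real ^ 'v \<Rightarrow> real ^ 'v" where "cl u = (\<chi> i. max (lo $ i) (min (hi $ i) (u $ i)))" for u
  have lohi: "lo $ i \<le> hi $ i" for i
    using e_box by (auto simp: rect_def intro: order_trans)
  have cl_box: "cl u \<in> rect lo hi" for u
    using lohi by (auto simp: cl_def rect_def)
  have cl_id: "cl u = u" if "u \<in> rect lo hi" for u
    using that by (auto simp: cl_def rect_def vec_eq_iff)
  obtain \<Lambda> where \<Lambda>: "\<Lambda> > 0" "\<And>i j u. u \<in> rect lo hi \<Longrightarrow> \<bar>a i j u\<bar> \<le> \<Lambda>"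
    using bounded_derivatives[OF hi(1)] by blast
  define G :: "real ^ 'v \<Rightarrow> real ^ 'v" where "G u = (\<chi> i. f i (cl u))" for u
  define n where "n = real CARD('v)"
  have lip_box: "\<bar>f i u - f i v\<bar> \<le> n * \<Lambda> * norm (u - v)" if "u \<in> rect lo hi" "v \<in> rect lo hi" for u v i
  proof -
    obtain \<xi> where \<xi>: "\<xi> \<in> rect lo hi" "f i u - f i v = (\<Sum>j\<in>UNIV. a i j \<xi> * (u $ j - v $ j))"
      using mean_value_box[OF hi(1) \<open>u \<in> rect lo hi\<close> \<open>v \<in> rect lo hi\<close>] by blast
    have "\<bar>a i j \<xi> * (u $ j - v $ j)\<bar> \<le> \<Lambda> * norm (u - v)" for j
      unfolding abs_mult using \<Lambda> \<xi>(1) component_le_norm_cart[of "u - v" j]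
      by (intro mult_mono) auto
    then have "\<bar>\<Sum>j\<in>UNIV. a i j \<xi> * (u $ j - v $ j)\<bar> \<le> (\<Sum>j\<in>(UNIV::'v set). \<Lambda> * norm (u - v))"
      by (intro order_trans[OF sum_abs] sum_mono)
    then show ?thesis
      by (simp add: \<xi>(2) n_def)
  qed
  have cl_lip: "norm (cl u - cl v) \<le> norm (u - v)" for u v
    by (rule norm_le_componentwise_cart) (auto simp: cl_def max_def min_def)
  have "norm (G u - G v) \<le> (n * n * \<Lambda>) * norm (u - v)" for u v
  proof -
    have "norm (G u - G v) \<le> (\<Sum>i\<in>UNIV. \<bar>(G u - G v) $ i\<bar>)"
      by (rule norm_le_l1_cart)
    also have "\<dots> \<le> (\<Sum>i\<in>(UNIV::'v set). n * \<Lambda> * norm (u - v))"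
    proof (rule sum_mono)
      fix i
      have "\<bar>(G u - G v) $ i\<bar> \<le> n * \<Lambda> * norm (cl u - cl v)"
        using lip_box[OF cl_box cl_box] by (simp add: G_def)
      also have "\<dots> \<le> n * \<Lambda> * norm (u - v)"
        using cl_lip \<Lambda>(1) by (intro mult_left_mono) (auto simp: n_def)
      finally show "\<bar>(G u - G v) $ i\<bar> \<le> n * \<Lambda> * norm (u - v)" .
    qed
    finally show ?thesis by (simp add: n_def)
  qed
  moreover obtain B where "\<And>u. norm (G u) \<le> B"
  proof -
    have "compact (G ` rect lo hi)"
    proof (rule compact_continuous_image[OF _ compact_box])
      show "continuous_on (rect lo hi) G"
        using calculation \<Lambda>(1)
        by (intro lipschitz_on_continuous_on[of "n * n * \<Lambda>"] lipschitz_onI) (auto simp: dist_norm n_def)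
    qed
    then obtain B where "\<forall>x\<in>G ` rect lo hi. norm x \<le> B"
      using compact_imp_bounded bounded_iff by blast
    moreover have "G u = G (cl u)" for u
      by (simp add: G_def cl_id[OF cl_box])
    ultimately have "norm (G u) \<le> B" for u
      using cl_box by (metis imageI)
    then show ?thesis by (rule that)
  qed
  ultimately obtain u where u: "u 0 = u0"
      "\<And>t. t \<ge> 0 \<Longrightarrow> (u has_vector_derivative G (u t)) (at t within {0..})"
    using lipschitz_ode_solution by metis
  have du: "((\<lambda>s. u s $ i) has_real_derivative f i (cl (u t))) (at t within {0..})" if "t \<ge> 0" for t i
    using bounded_linear.has_vector_derivative[OF bounded_linear_vec_nth u(2)[OF that], of i]
    by (simp add: G_def has_real_derivative_iff_has_vector_derivative)
  have in_box: "u t \<in> rect lo hi" if t: "t \<ge> 0" for t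
  proof -
    have "u t $ i \<le> hi $ i" for i
    proof (rule real_barrier_le[OF du _ _ t])
      show "u 0 $ i \<le> hi $ i"
        using hi u(1) by simp
      fix t :: real assume "hi $ i < u t $ i"
      then have "cl (u t) $ i = hi $ i"
        using lohi[of i] by (simp add: cl_def)
      then show "f i (cl (u t)) \<le> 0"
        using up[of "cl (u t)" i] cl_box[of "u t"] rect_subset_cube[OF hi(1)] by (auto simp: rect_def)
    qed auto
    moreover have "- u t $ i \<le> - lo $ i" for i
    proof (rule real_barrier_le[where \<phi>' = "\<lambda>t. - f i (cl (u t))", OF _ _ _ t])
      show "((\<lambda>t. - u t $ i) has_real_derivative - f i (cl (u t))) (at t within {0..})" if "t \<ge> 0" for t
        using du[OF that] by (rule DERIV_minus)
      show "- u 0 $ i \<le> - lo $ i"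
        using u0_box u(1) by (simp add: rect_def)
      fix t :: real assume "- lo $ i < - u t $ i"
      then have "cl (u t) $ i = lo $ i"
        using lohi[of i] by (simp add: cl_def)
      then show "- f i (cl (u t)) \<le> 0"
        using down[OF cl_box] by simp
    qed
    ultimately show ?thesis by (auto simp: rect_def)
  qed
  show ?thesis
  proof (rule that)
    show "hi \<in> cube J" "e \<in> rect lo hi" "u 0 = u0" "\<And>t. t \<ge> 0 \<Longrightarrow> u t \<in> rect lo hi"
      by (fact hi(1) e_box u(1) in_box)+
    show "solution {0..} u"
      unfolding solution_def using du in_box cl_id rect_subset_cube[OF hi(1)] by fastforce
  qed
qed

lemma solution_subset: "solution I u \<Longrightarrow> I' \<subseteq> I \<Longrightarrow> solution I' u"
  unfolding solution_def by (meson DERIV_subset subsetD)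

lemma solution_exists: "u0 \<in> cube J \<Longrightarrow> \<exists>u. solution {0..} u \<and> u 0 = u0"
  using trapped_solution by metis

text \<open>Uniqueness on each \<open>[0,t]\<close> with \<open>t < T\<close> identifies the given
  solution with the global one from the same initial point, so its behaviour near \<open>T\<close>
  need not be analysed.\<close>

lemma solution_extends:
  assumes "T > 0" and u: "solution {0..<T} u"
  shows "\<exists>u'. solution {0..} u' \<and> (\<forall>t\<in>{0..<T}. u' t = u t)"
proof -
  have "u 0 \<in> cube J"
    using assms by (auto simp: solution_def)
  then obtain u' where u': "solution {0..} u'" "u' 0 = u 0"
    using solution_exists by blast
  have "u' t = u t" if "t \<in> {0..<T}" for t
  proof (rule solution_unique)
    show "solution {0..t} u'"
      by (rule solution_subset[OF u'(1)]) auto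
    show "solution {0..t} u"
      by (rule solution_subset[OF u]) (use that in auto)
  qed (use that u' in auto)
  then show ?thesis
    using u'(1) by blast
qed

lemma solution_trapped:
  assumes u: "solution {0..} u"
  obtains lo hi where "hi \<in> cube J" "e \<in> rect lo hi" "\<And>t. t \<ge> 0 \<Longrightarrow> u t \<in> rect lo hi"
proof -
  have "u 0 \<in> cube J"
    using u by (auto simp: solution_def)
  then obtain lo hi v where v: "hi \<in> cube J" "e \<in> rect lo hi" "v 0 = u 0" "solution {0..} v"
      "\<And>t. t \<ge> 0 \<Longrightarrow> v t \<in> rect lo hi"
    using trapped_solution by metis
  have "u t = v t" if "t \<ge> 0" for t
    by (rule solution_unique[of t])
      (use v(3) that solution_subset[OF u, of "{0..t}"] solution_subset[OF v(4), of "{0..t}"] in auto)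
  with v that show ?thesis by metis
qed

section \<open>Exponential convergence to the equilibrium\<close>

lemma pos_lower_bound_on_box:
  assumes "hi \<in> cube J" "continuous_on (cube J) g" "\<And>u. u \<in> cube J \<Longrightarrow> g u > (0::real)"
  shows "\<exists>\<delta>>0. \<forall>u\<in>rect lo hi. g u \<ge> \<delta>"
proof (cases "rect lo hi = {}")
  case False
  then obtain u where "u \<in> rect lo hi" "\<forall>v\<in>rect lo hi. g u \<le> g v"
    using continuous_attains_inf[OF compact_box, of lo hi g] assms(2) rect_subset_cube[OF assms(1)]
      continuous_on_subset by metis
  then show ?thesis
    using assms(3) rect_subset_cube[OF assms(1)] by blast
qed (auto intro: exI[of _ 1])

text \<open>
  The row sums are only known to be strictly negative at \<open>i0\<close>. The weights increase with the distance
  to \<open>i0\<close>, with geometrically decreasing increments: the gain from a neighbour that is closer to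
  \<open>i0\<close> then outweighs the loss from all other vertices.
\<close>

lemma contracting_weights:
  assumes hi: "hi \<in> cube J"
  obtains p c where "\<And>i. p i > 0" "c > 0"
    and "\<And>i u. u \<in> rect lo hi \<Longrightarrow> (\<Sum>j\<in>UNIV. a i j u * p j) \<le> - c * p i"
proof -
  obtain \<Lambda> where \<Lambda>: "\<Lambda> > 0" "\<And>i j u. u \<in> rect lo hi \<Longrightarrow> \<bar>a i j u\<bar> \<le> \<Lambda>"
    using bounded_derivatives[OF hi] by blast
  have "\<exists>\<delta>>0. \<forall>u\<in>rect lo hi. (i, j) \<in> E \<longrightarrow> a i j u \<ge> \<delta>" for i j
    using pos_lower_bound_on_box[OF hi cont, of i j] edge by (cases "(i, j) \<in> E") (auto intro: exI[of _ 1])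
  then obtain \<delta>e where \<delta>e: "\<And>i j. \<delta>e i j > 0" "\<And>i j u. u \<in> rect lo hi \<Longrightarrow> (i, j) \<in> E \<Longrightarrow> a i j u \<ge> \<delta>e i j"
    by metis
  obtain \<delta>0 where \<delta>0: "\<delta>0 > 0" "\<And>u. u \<in> rect lo hi \<Longrightarrow> - (\<Sum>j\<in>UNIV. a i0 j u) \<ge> \<delta>0"
    using pos_lower_bound_on_box[OF hi, of "\<lambda>u. - (\<Sum>j\<in>UNIV. a i0 j u)"] row_sum_i0 cont
    by (force intro!: continuous_intros)
  define \<delta> where "\<delta> = Min (insert \<delta>0 (range (\<lambda>(i, j). \<delta>e i j)))"
  have "\<delta> \<le> x" if "x \<in> insert \<delta>0 (range (\<lambda>(i, j). \<delta>e i j))" for x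
    unfolding \<delta>_def using that by (intro Min_le) auto
  then have \<delta>: "\<delta> > 0" "\<delta> \<le> \<delta>0" "\<delta> \<le> \<delta>e i j" for i j
    using \<delta>0(1) \<delta>e(1) by (auto simp: \<delta>_def)
  define n where "n = real CARD('v)"
  have n: "n \<ge> 1"
    by (simp add: n_def Suc_le_eq)
  \<comment> \<open>Solves \<open>n * \<Lambda> * \<eta> + \<delta> * \<eta> = \<delta> / 2\<close>.
    At distance \<open>d > 0\<close> the closer neighbour gains
    \<open>\<delta> * \<eta> ^ d * (1 - \<eta>)\<close>, the other vertices together lose at most
    \<open>n * \<Lambda> * \<eta> ^ Suc d\<close>, and half of \<open>\<delta> * \<eta> ^ d\<close>
    is left.\<close>
  define \<eta> where "\<eta> = \<delta> / 2 / (n * \<Lambda> + \<delta>)"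
  have pos: "n * \<Lambda> + \<delta> > 0"
    using n \<Lambda>(1) \<delta>(1) by (simp add: add_pos_pos)
  have \<eta>_pos: "\<eta> > 0"
    using pos \<delta>(1) by (simp add: \<eta>_def)
  have \<eta>_eq: "n * \<Lambda> * \<eta> + \<delta> * \<eta> = \<delta> / 2"
  proof -
    have "(n * \<Lambda> + \<delta>) * \<eta> = \<delta> / 2"
      using pos unfolding \<eta>_def
      by (metis less_irrefl nonzero_mult_div_cancel_left times_divide_eq_right)
    then show ?thesis by (simp add: distrib_right)
  qed
  have "\<delta> * \<eta> \<le> \<delta> / 2"
    using \<eta>_eq n \<Lambda>(1) \<eta>_pos by (smt (verit) mult_nonneg_nonneg)
  then have \<eta>_le: "\<eta> \<le> 1/2"
    using \<delta>(1) by (simp add: field_simps)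
  have "\<exists>n. (i, i0) \<in> E ^^ n" for i
    using connected[of i i0] rtrancl_imp_relpow by blast
  define d where "d i = (LEAST n. (i, i0) \<in> E ^^ n)" for i
  have d: "(i, i0) \<in> E ^^ d i" for i
    unfolding d_def by (rule LeastI_ex) fact
  have d_zero: "d i = 0 \<Longrightarrow> i = i0" for i
    using d[of i] by auto
  have d_Suc: "\<exists>j. (i, j) \<in> E \<and> d j \<le> m" if "d i = Suc m" for i m
  proof -
    from d[of i] that obtain j where "(i, j) \<in> E" "(j, i0) \<in> E ^^ m"
      by (metis relpow_Suc_E2)
    then show ?thesis
      unfolding d_def by (meson Least_le)
  qed
  \<comment> \<open>All weights stay below the common limit 2, so no vertex, however far away,
    exceeds \<open>p i\<close> by more than \<open>\<eta> ^ Suc (d i)\<close>.\<close>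
  define p where "p i = 2 - \<eta> ^ Suc (d i)" for i
  have p: "1 \<le> p i" "p i \<le> 2" for i
    using \<eta>_pos \<eta>_le power_le_one[of \<eta> "Suc (d i)"] zero_le_power[of \<eta> "Suc (d i)"] by (auto simp: p_def)
  have p_diff: "p j - p i \<le> \<eta> ^ Suc (d i)" for i j
    using \<eta>_pos zero_le_power[of \<eta> "Suc (d j)"] by (auto simp: p_def)
  have row: "(\<Sum>j\<in>UNIV. a i j u * p j) \<le> - (\<eta> ^ d i * \<delta> / 2)" if u: "u \<in> rect lo hi" for i u
  proof -
    have uD: "u \<in> cube J"
      using u rect_subset_cube[OF hi] by auto
    have split: "(\<Sum>j\<in>UNIV. a i j u * p j) = p i * (\<Sum>j\<in>UNIV. a i j u) + (\<Sum>j\<in>UNIV. a i j u * (p j - p i))"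
      by (simp add: sum_distrib_left algebra_simps sum_subtractf)
    have term_le: "a i j u * (p j - p i) \<le> \<Lambda> * \<eta> ^ Suc (d i)" for j
    proof (cases "j = i")
      case False
      have "a i j u * (p j - p i) \<le> a i j u * \<eta> ^ Suc (d i)"
        using offdiag[OF uD, of i j] False p_diff by (intro mult_left_mono) auto
      also have "\<dots> \<le> \<Lambda> * \<eta> ^ Suc (d i)"
        using \<Lambda>(2)[OF u, of i j] \<eta>_pos by (intro mult_right_mono) auto
      finally show ?thesis .
    qed (use \<Lambda>(1) \<eta>_pos in auto)
    show ?thesis
    proof (cases "d i")
      \<comment> \<open>At \<open>i0\<close> the strictly negative row sum takes the place of the
        closer neighbour.\<close>
      case 0
      then have "i = i0" by (rule d_zero)
      have "p i * (\<Sum>j\<in>UNIV. a i j u) \<le> - \<delta>"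
      proof -
        have s: "(\<Sum>j\<in>UNIV. a i j u) \<le> - \<delta>"
          using \<delta>0(2)[OF u] \<delta>(2) \<open>i = i0\<close> by simp
        then have "p i * (\<Sum>j\<in>UNIV. a i j u) \<le> 1 * (\<Sum>j\<in>UNIV. a i j u)"
          using p(1)[of i] \<delta>(1) by (intro mult_right_mono_neg) auto
        with s show ?thesis by simp
      qed
      moreover have "(\<Sum>j\<in>UNIV. a i j u * (p j - p i)) \<le> (\<Sum>j\<in>(UNIV::'v set). \<Lambda> * \<eta> ^ Suc (d i))"
        by (rule sum_mono) (rule term_le)
      moreover have "(\<Sum>j\<in>(UNIV::'v set). \<Lambda> * \<eta> ^ Suc (d i)) \<le> \<delta> / 2"
        using \<eta>_eq \<delta>(1) \<eta>_pos 0 by (simp add: n_def mult_ac) (smt (verit) mult_nonneg_nonneg)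
      ultimately show ?thesis
        using split 0 by simp
    next
      case (Suc m)
      obtain k where k: "(i, k) \<in> E" "d k \<le> m"
        using d_Suc[OF Suc] by blast
      have "i \<noteq> k" and aik: "a i k u \<ge> \<delta>"
        using edge[OF uD k(1)] \<delta>e(2)[OF u k(1)] \<delta>(3)[of i k] by auto
      have "p i * (\<Sum>j\<in>UNIV. a i j u) \<le> 0"
        using p(1)[of i] row_sum[OF uD, of i] by (simp add: mult_nonneg_nonpos)
      moreover have "(\<Sum>j\<in>UNIV. a i j u * (p j - p i)) =
          a i k u * (p k - p i) + (\<Sum>j\<in>UNIV - {k}. a i j u * (p j - p i))"
        by (simp add: sum.remove)
      moreover have "(\<Sum>j\<in>UNIV - {k}. a i j u * (p j - p i)) \<le> n * \<Lambda> * \<eta> ^ Suc (d i)"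
      proof -
        have "(\<Sum>j\<in>UNIV - {k}. a i j u * (p j - p i)) \<le> (\<Sum>j\<in>UNIV - {k}. \<Lambda> * \<eta> ^ Suc (d i))"
          by (rule sum_mono) (rule term_le)
        also have "\<dots> \<le> (\<Sum>j\<in>(UNIV::'v set). \<Lambda> * \<eta> ^ Suc (d i))"
          using \<Lambda>(1) \<eta>_pos by (intro sum_mono2) auto
        finally show ?thesis by (simp add: n_def)
      qed
      moreover have "a i k u * (p k - p i) \<le> - (\<delta> * (\<eta> ^ d i * (1 - \<eta>)))"
      proof -
        have "\<eta> ^ d i \<le> \<eta> ^ Suc (d k)"
          using k(2) Suc \<eta>_pos \<eta>_le by (intro power_decreasing) auto
        then have diff: "p k - p i \<le> - (\<eta> ^ d i * (1 - \<eta>))"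
          by (simp add: p_def algebra_simps)
        have nn: "\<eta> ^ d i * (1 - \<eta>) \<ge> 0"
          using \<eta>_pos \<eta>_le by simp
        have "a i k u * (p k - p i) \<le> a i k u * - (\<eta> ^ d i * (1 - \<eta>))"
          using diff aik \<delta>(1) by (intro mult_left_mono) auto
        also have "\<dots> \<le> \<delta> * - (\<eta> ^ d i * (1 - \<eta>))"
          using aik nn by (intro mult_right_mono_neg) auto
        finally show ?thesis by simp
      qed
      moreover have "n * \<Lambda> * \<eta> ^ Suc (d i) - \<delta> * (\<eta> ^ d i * (1 - \<eta>)) = - (\<eta> ^ d i * \<delta> / 2)"
      proof -
        have "n * \<Lambda> * \<eta> ^ Suc (d i) - \<delta> * (\<eta> ^ d i * (1 - \<eta>)) = \<eta> ^ d i * ((n * \<Lambda> * \<eta> + \<delta> * \<eta>) - \<delta>)"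
          by (simp add: algebra_simps)
        then show ?thesis by (simp add: \<eta>_eq)
      qed
      ultimately show ?thesis
        using split by linarith
    qed
  qed
  \<comment> \<open>A quarter instead of the available half, because \<open>p i\<close> can be
    almost 2.\<close>
  define c where "c = Min (range (\<lambda>i. \<eta> ^ d i * \<delta> / 4))"
  have c_le: "c \<le> \<eta> ^ d i * \<delta> / 4" for i
    unfolding c_def by (rule Min_le) auto
  have c_pos: "c > 0"
    using \<eta>_pos \<delta>(1) by (auto simp: c_def)
  show ?thesis
  proof (rule that[of p c])
    show "p i > 0" for i using p(1)[of i] by simp
    show "c > 0" by fact
    fix i u assume "u \<in> rect lo hi"
    from row[OF this, of i] have "(\<Sum>j\<in>UNIV. a i j u * p j) \<le> - (\<eta> ^ d i * \<delta> / 2)" .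
    also have "\<dots> \<le> - (c * 2)"
      using c_le[of i] by simp
    also have "\<dots> \<le> - (c * p i)"
      using c_pos p(2)[of i] by simp
    finally show "(\<Sum>j\<in>UNIV. a i j u * p j) \<le> - c * p i" by simp
  qed
qed

text \<open>Trapping puts all mean value points into one compact box, on which the contracting
  weights are uniform. The rate is halved to give the maximum principle its strict gap. The box is
  part of the conclusion because the passage from \<open>u\<close> to radii is Lipschitz only on
  compact sets.\<close>

theorem solution_converges:
  assumes u: "solution {0..} u"
  obtains lo hi C c where "hi \<in> cube J" "e \<in> rect lo hi" "\<And>t. t \<ge> 0 \<Longrightarrow> u t \<in> rect lo hi"
    and "C > 0" "c > 0" "\<And>t i. t \<ge> 0 \<Longrightarrow> \<bar>u t $ i - e $ i\<bar> \<le> C * exp (- c * t)"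
proof -
  obtain lo hi where hi: "hi \<in> cube J" and e: "e \<in> rect lo hi" and ub: "\<And>t. t \<ge> 0 \<Longrightarrow> u t \<in> rect lo hi"
    using solution_trapped[OF u] by blast
  obtain p c where p: "\<And>i. p i > 0" and c: "c > 0"
    and row: "\<And>i u. u \<in> rect lo hi \<Longrightarrow> (\<Sum>j\<in>UNIV. a i j u * p j) \<le> - c * p i"
    using contracting_weights[OF hi] by metis
  define K where "K = 1 + (\<Sum>i\<in>UNIV. \<bar>u 0 $ i - e $ i\<bar> / p i)"
  have nn: "0 \<le> \<bar>u 0 $ i - e $ i\<bar> / p i" for i
    using p[of i] by simp
  have K: "K > 0"
    unfolding K_def using nn by (intro add_pos_nonneg sum_nonneg) auto
  have K_init: "\<bar>u 0 $ i - e $ i\<bar> < K * p i" for i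
  proof -
    have "\<bar>u 0 $ i - e $ i\<bar> / p i \<le> (\<Sum>i\<in>UNIV. \<bar>u 0 $ i - e $ i\<bar> / p i)"
      using nn by (intro member_le_sum) auto
    then have "\<bar>u 0 $ i - e $ i\<bar> / p i < K"
      by (simp add: K_def)
    then show ?thesis
      using p[of i] by (simp add: field_simps)
  qed
  have est: "\<bar>u t $ i - e $ i\<bar> < K * p i * exp (- (c / 2) * t)" if t: "t \<ge> 0" for t i
  proof (rule weighted_max_principle[where c = c and w = "\<lambda>t i. u t $ i - e $ i" and
          w' = "\<lambda>t i. f i (u t)" and T = t and p = p, OF p K])
    fix s i assume s: "s \<in> {0..t}"
    have "((\<lambda>s. u s $ i) has_real_derivative f i (u s)) (at s within {0..})"
      using u s by (auto simp: solution_def)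
    then have "((\<lambda>s. u s $ i) has_real_derivative f i (u s)) (at s within {0..t})"
      by (rule DERIV_subset) auto
    then show "((\<lambda>s. u s $ i - e $ i) has_real_derivative f i (u s)) (at s within {0..t})"
      by (auto intro!: derivative_eq_intros)
    obtain \<xi> where \<xi>: "\<xi> \<in> rect lo hi" "\<xi> \<in> cube J" "f i (u s) - f i e = (\<Sum>j\<in>UNIV. a i j \<xi> * (u s $ j - e $ j))"
      using mean_value_box[OF hi ub e, of s i] s by auto
    assume "\<And>j. \<bar>u s $ j - e $ j\<bar> * p i \<le> \<bar>u s $ i - e $ i\<bar> * p j"
    then have "sgn (u s $ i - e $ i) * (\<Sum>j\<in>UNIV. a i j \<xi> * (u s $ j - e $ j))
        \<le> \<bar>u s $ i - e $ i\<bar> / p i * (\<Sum>j\<in>UNIV. a i j \<xi> * p j)"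
      using offdiag[OF \<xi>(2)] p
      by (intro cooperative_row_at_weighted_max[where p = p and w = "\<lambda>j. u s $ j - e $ j"]) auto
    also have "\<dots> \<le> \<bar>u s $ i - e $ i\<bar> / p i * (- c * p i)"
      using row[OF \<xi>(1)] p[of i] by (intro mult_left_mono) auto
    also have "\<dots> = - c * \<bar>u s $ i - e $ i\<bar>"
      using p[of i] by simp
    finally show "sgn (u s $ i - e $ i) * f i (u s) \<le> - c * \<bar>u s $ i - e $ i\<bar>"
      using \<xi>(3) equilibrium by simp
  qed (use K_init t c in auto)
  define C where "C = K * (\<Sum>i\<in>UNIV. p i)"
  have pC: "p i \<le> (\<Sum>i\<in>UNIV. p i)" for i
    using p by (intro member_le_sum) (auto intro: less_imp_le)
  have "(\<Sum>i\<in>UNIV. p i) > 0"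
    using p by (intro sum_pos) auto
  then have "C > 0"
    using K by (simp add: C_def)
  moreover have "\<bar>u t $ i - e $ i\<bar> \<le> C * exp (- (c / 2) * t)" if "t \<ge> 0" for t i
  proof -
    have "K * p i * exp (- (c / 2) * t) \<le> C * exp (- (c / 2) * t)"
      unfolding C_def using K pC by (intro mult_right_mono mult_left_mono) auto
    then show ?thesis using est[OF that, of i] by linarith
  qed
  ultimately show ?thesis
    using that[OF hi e ub, of C "c / 2"] c by simp
qed

text \<open>Another zero of the field is a stationary solution: its distance to \<open>e\<close> is
  constant and yet decays to 0.\<close>

theorem equilibrium_unique:
  assumes v: "v \<in> cube J" "\<And>i. f i v = 0"
  shows "v = e"
proof -
  have "solution {0..} (\<lambda>_. v)"
    using v by (auto simp: solution_def)
  then obtain C c where C: "C > 0" "c > 0" "\<And>t i. t \<ge> (0::real) \<Longrightarrow> \<bar>v $ i - e $ i\<bar> \<le> C * exp (- c * t)"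
    by (rule solution_converges) blast
  have lim: "((\<lambda>t. C * exp (- c * t)) \<longlongrightarrow> 0) at_top"
    using C(1,2) by real_asymp
  have "\<bar>v $ i - e $ i\<bar> \<le> 0" for i
    by (rule tendsto_lowerbound[OF lim]) (use C(3) in \<open>auto intro: eventually_at_top_linorderI[of 0]\<close>)
  then show ?thesis
    by (simp add: vec_eq_iff)
qed

end

section \<open>Angles of triangles of circles\<close>

text \<open>Suited to the law of cosines: all that remains to be understood is the numerator
  \<open>N' * S - N * S' / 2\<close> and the discriminant \<open>S - N\<^sup>2\<close>.\<close>

lemma DERIV_arccos_quotient_sqrt:
  assumes N: "(N has_real_derivative N') (at s)" and S: "(S has_real_derivative S') (at s)"
    and pos: "S s > 0" and lt: "(N s)\<^sup>2 < S s"
  shows "((\<lambda>s. arccos (N s / sqrt (S s))) has_real_derivative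
           - (N' * S s - N s * S' / 2) / (S s * sqrt (S s - (N s)\<^sup>2))) (at s)"
proof -
  have "(N s / sqrt (S s))\<^sup>2 < 1"
    using pos lt by (simp add: power_divide)
  then have q: "\<bar>N s / sqrt (S s)\<bar> < 1"
    using abs_square_less_1 by blast
  have "1 - (N s / sqrt (S s))\<^sup>2 = (S s - (N s)\<^sup>2) / S s"
    using pos by (simp add: power_divide field_simps)
  then have sq: "sqrt (1 - (N s / sqrt (S s))\<^sup>2) = sqrt (S s - (N s)\<^sup>2) / sqrt (S s)"
    by (simp add: real_sqrt_divide)
  have ne: "sqrt (S s - (N s)\<^sup>2) \<noteq> 0" "sqrt (S s) \<noteq> 0"
    using pos lt by auto
  have dq: "((\<lambda>s. N s / sqrt (S s)) has_real_derivative
      (N' * sqrt (S s) - N s * (S' / (2 * sqrt (S s)))) / S s) (at s)"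
    using N S pos by (auto intro!: derivative_eq_intros simp: field_simps)
  have "((\<lambda>s. arccos (N s / sqrt (S s))) has_real_derivative
      inverse (- sqrt (1 - (N s / sqrt (S s))\<^sup>2)) * ((N' * sqrt (S s) - N s * (S' / (2 * sqrt (S s)))) / S s)) (at s)"
    by (rule DERIV_chain2[OF DERIV_arccos dq]) (use q in linarith)+
  also have "inverse (- sqrt (1 - (N s / sqrt (S s))\<^sup>2)) * ((N' * sqrt (S s) - N s * (S' / (2 * sqrt (S s)))) / S s)
     = - (N' * (sqrt (S s) * sqrt (S s)) - N s * S' / 2) / (S s * sqrt (S s - (N s)\<^sup>2))"
    unfolding sq using ne by (simp add: field_simps)
  finally show ?thesis
    using pos by simp
qed

text \<open>
  Both geometries at once: \<open>k = 0\<close>, \<open>x = r\<close>, \<open>X = 1\<close> is the Euclidean and \<open>k = 1\<close>, \<open>x = sinh r\<close>,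
  \<open>X = cosh r\<close> the hyperbolic one, and in both \<open>X\<^sup>2 = 1 + k x\<^sup>2\<close>. Then \<open>edge_form\<close> is \<open>l\<^sup>2\<close> resp.
  \<open>sinh\<^sup>2 l\<close> for the edge length \<open>l\<close>, and the law of cosines reads
  \<open>cos \<theta> = cos_form / sqrt (edge_form * edge_form)\<close>. Here \<open>a\<close>, \<open>b\<close>, \<open>c\<close> are the cosines of the weights
  of the edges \<open>ij\<close>, \<open>ik\<close>, \<open>jk\<close>. In the \<open>u\<close>-coordinates \<open>x' = x X\<close> and \<open>X' = k x\<^sup>2\<close>.
\<close>

definition edge_form :: "real \<Rightarrow> real \<Rightarrow> real \<Rightarrow> real \<Rightarrow> real \<Rightarrow> real \<Rightarrow> real" where
  "edge_form k x X y Y a = x\<^sup>2 + y\<^sup>2 + 2 * X * Y * x * y * a + k * x\<^sup>2 * y\<^sup>2 * (1 + a\<^sup>2)"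

definition cos_form :: "real \<Rightarrow> real \<Rightarrow> real \<Rightarrow> real \<Rightarrow> real \<Rightarrow> real \<Rightarrow> real \<Rightarrow> real \<Rightarrow> real \<Rightarrow> real \<Rightarrow> real" where
  "cos_form k x X y Y z Z a b c = x\<^sup>2 * Y * Z + X * Y * x * z * b + X * Z * x * y * a + k * x\<^sup>2 * y * z * a * b - y * z * c"

text \<open>The left-hand side is the quotient rule for the cosine in the coordinate of the second
  vertex; the edge form of the edge \<open>ik\<close> does not depend on it and has been cancelled.
  For cosines in \<open>[0,1]\<close> the parenthesis on the right consists of nonnegative terms, so
  the angle at \<open>i\<close> does not decrease in \<open>u\<^sub>j\<close>.\<close>

lemma cos_form_quotient_dv:
  fixes k :: real
  assumes "X\<^sup>2 = 1 + k * x\<^sup>2" "Y\<^sup>2 = 1 + k * y\<^sup>2"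
  shows "(x\<^sup>2 * (k * y\<^sup>2) * Z + X * (k * y\<^sup>2) * x * z * b + X * Z * x * (y * Y) * a + k * x\<^sup>2 * (y * Y) * z * a * b - y * Y * z * c)
     * edge_form k x X y Y a
   - cos_form k x X y Y z Z a b c * (y * (y * Y) + X * (k * y\<^sup>2) * x * y * a + X * Y * x * (y * Y) * a + k * x\<^sup>2 * y * (y * Y) * (1 + a\<^sup>2))
   = - (x * y * (x * Y * z * (c + a * b) + x * y * Z * (1 - a\<^sup>2) + y * z * X * (b + a * c)))"
  using assms unfolding edge_form_def cos_form_def by algebra

text \<open>The left-hand side is the product of the edge forms times the squared sine of the angle;
  for \<open>k = 0\<close> it is four times the squared area. For cosines in \<open>[0,1]\<close> no
  term on the right is negative, so positivity of this expression stands in for a triangle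
  inequality.\<close>

lemma disc_form_eq:
  fixes k :: real
  assumes "X\<^sup>2 = 1 + k * x\<^sup>2" "Y\<^sup>2 = 1 + k * y\<^sup>2" "Z\<^sup>2 = 1 + k * z\<^sup>2"
  shows "edge_form k x X y Y a * edge_form k x X z Z b - (cos_form k x X y Y z Z a b c)\<^sup>2 =
     x\<^sup>2 * y\<^sup>2 * (1 - a\<^sup>2) + x\<^sup>2 * z\<^sup>2 * (1 - b\<^sup>2) + y\<^sup>2 * z\<^sup>2 * (1 - c\<^sup>2)
     + 2 * x * y * z * (x * Y * Z * (c + a * b) + y * X * Z * (b + a * c) + z * X * Y * (a + b * c))
     + 2 * k * x\<^sup>2 * y\<^sup>2 * z\<^sup>2 * (1 + a * b * c)"
  using assms unfolding edge_form_def cos_form_def by algebra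

text \<open>
  With \<open>A\<close>, \<open>B\<close>, \<open>C\<close> the hyperbolic cosines of the edge lengths, the left-hand side is, up to a positive
  factor, the derivative of \<open>cos \<theta>\<close> when all three \<open>u\<close>-coordinates grow at unit speed.
\<close>

lemma row_form_eq:
  fixes x y z X Y Z a b c :: real
  assumes "X\<^sup>2 = 1 + x\<^sup>2" "Y\<^sup>2 = 1 + y\<^sup>2" "Z\<^sup>2 = 1 + z\<^sup>2"
    and "A = X * Y + x * y * a" "B = X * Z + x * z * b" "C = Y * Z + y * z * c"
  shows "(2 * X * C + Y + Z) * (A + 1) * (B + 1) - (X + Y) * (B + C) * (B + 1) - (X + Z) * (A + C) * (A + 1)
    = x * y * z * (z * (b * c + a) * (X + Y) + y * (b + a * c) * (X + Z))
    + x\<^sup>2 * z\<^sup>2 * (1 - b\<^sup>2) * (X + Y) + x\<^sup>2 * y\<^sup>2 * (1 - a\<^sup>2) * (X + Z)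
    + x\<^sup>2 * y * z * (c + a * b) * (Y + Z + 2 * X * Y * Z)
    + 2 * x\<^sup>2 * y\<^sup>2 * z\<^sup>2 * X * (1 + a * b * c)
    + 2 * x^3 * y * z * (z * (b * c + a) * Y + y * (b + a * c) * Z)"
  using assms by algebra


lemma edge_form_pos:
  assumes "k \<ge> 0" "x > 0" "y > 0" "X > 0" "Y > 0" "0 \<le> a"
  shows "edge_form k x X y Y a > 0"
  unfolding edge_form_def using assms by (intro add_pos_nonneg mult_nonneg_nonneg) auto

lemma disc_form_pos:
  fixes k :: real
  assumes "X\<^sup>2 = 1 + k * x\<^sup>2" "Y\<^sup>2 = 1 + k * y\<^sup>2" "Z\<^sup>2 = 1 + k * z\<^sup>2" "k \<ge> 0"
    and pos: "x > 0" "y > 0" "z > 0" "X > 0" "Y > 0" "Z > 0"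
    and c: "0 \<le> a" "a \<le> 1" "0 \<le> b" "b \<le> 1" "0 \<le> c" "c \<le> 1"
  shows "(cos_form k x X y Y z Z a b c)\<^sup>2 < edge_form k x X y Y a * edge_form k x X z Z b"
proof -
  have sq: "a\<^sup>2 \<le> 1" "b\<^sup>2 \<le> 1" "c\<^sup>2 \<le> 1"
    using c by (simp_all add: power_le_one)
  let ?t1 = "x\<^sup>2 * y\<^sup>2 * (1 - a\<^sup>2)"
  let ?t2 = "2 * x * y * z * (x * Y * Z * (c + a * b) + y * X * Z * (b + a * c) + z * X * Y * (a + b * c))"
  have t1: "?t1 \<ge> 0" using sq by simp
  have t2: "?t2 \<ge> 2 * x * y * z * (z * X * Y * a)"
    using pos c by (intro mult_left_mono) (auto simp: algebra_simps intro!: add_nonneg_nonneg)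
  \<comment> \<open>The two terms cannot vanish together: the first is positive for
    \<open>a = 0\<close>, the second for \<open>a > 0\<close>.\<close>
  have "?t1 + ?t2 > 0"
  proof (cases "a = 0")
    case True
    then have "?t1 > 0" using pos by simp
    moreover have "?t2 \<ge> 0" using t2 unfolding True by simp
    ultimately show ?thesis by linarith
  next
    case False
    then have "2 * x * y * z * (z * X * Y * a) > 0" using pos c by simp
    with t1 t2 show ?thesis by linarith
  qed
  moreover have "x\<^sup>2 * z\<^sup>2 * (1 - b\<^sup>2) \<ge> 0" "y\<^sup>2 * z\<^sup>2 * (1 - c\<^sup>2) \<ge> 0"
    using sq by simp_all
  moreover have "2 * k * x\<^sup>2 * y\<^sup>2 * z\<^sup>2 * (1 + a * b * c) \<ge> 0"
    using c \<open>k \<ge> 0\<close> by simp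
  ultimately show ?thesis
    using disc_form_eq[OF assms(1-3), of a b c] by linarith
qed

text \<open>The expression is the quotient rule for the cosine when all three coordinates grow at
  unit speed. It is divisible by \<open>(A - 1) * (B - 1)\<close>, and the cofactor is the sum of
  nonnegative terms from \<open>row_form_eq\<close>.\<close>

lemma row_numerator_nonneg:
  fixes x y z X Y Z a b c :: real
  assumes rel: "X\<^sup>2 = 1 + x\<^sup>2" "Y\<^sup>2 = 1 + y\<^sup>2" "Z\<^sup>2 = 1 + z\<^sup>2"
    and pos: "x > 0" "y > 0" "z > 0" "X \<ge> 1" "Y \<ge> 1" "Z \<ge> 1"
    and c: "0 \<le> a" "a \<le> 1" "0 \<le> b" "b \<le> 1" "0 \<le> c" "c \<le> 1"
    and A: "A = X * Y + x * y * a" and B: "B = X * Z + x * z * b" and C: "C = Y * Z + y * z * c"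
  shows "0 \<le> (A * ((X + Z) * (B - 1)) + B * ((X + Y) * (A - 1)) - (Y + Z) * (C - 1)) * ((A\<^sup>2 - 1) * (B\<^sup>2 - 1))
      - (A * B - C) * ((X + Y) * (A - 1) * A * (B\<^sup>2 - 1) + (A\<^sup>2 - 1) * ((X + Z) * (B - 1) * B))"
proof -
  have sq: "a\<^sup>2 \<le> 1" "b\<^sup>2 \<le> 1"
    using c by (simp_all add: power_le_one)
  have "(2 * X * C + Y + Z) * (A + 1) * (B + 1) - (X + Y) * (B + C) * (B + 1) - (X + Z) * (A + C) * (A + 1) \<ge> 0"
    unfolding row_form_eq[OF rel A B C] using pos c sq
    by (intro add_nonneg_nonneg mult_nonneg_nonneg) auto
  moreover have "A \<ge> 1" "B \<ge> 1"
  proof -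
    have "X * Y \<ge> 1 * 1" "X * Z \<ge> 1 * 1"
      using pos by (intro mult_mono; simp)+
    moreover have "x * y * a \<ge> 0" "x * z * b \<ge> 0"
      using pos c by simp_all
    ultimately show "A \<ge> 1" "B \<ge> 1" unfolding A B by linarith+
  qed
  ultimately have "0 \<le> (A - 1) * (B - 1) *
     ((2 * X * C + Y + Z) * (A + 1) * (B + 1) - (X + Y) * (B + C) * (B + 1) - (X + Z) * (A + C) * (A + 1))"
    by simp
  also have "\<dots> = (A * ((X + Z) * (B - 1)) + B * ((X + Y) * (A - 1)) - (Y + Z) * (C - 1)) * ((A\<^sup>2 - 1) * (B\<^sup>2 - 1))
      - (A * B - C) * ((X + Y) * (A - 1) * A * (B\<^sup>2 - 1) + (A\<^sup>2 - 1) * ((X + Z) * (B - 1) * B))"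
    by algebra
  finally show ?thesis .
qed

text \<open>Here and in the next two definitions: partial derivatives by the rules
  \<open>x' = x * X\<close> and \<open>X' = k * x\<^sup>2\<close>, with \<open>du\<close> for the
  first vertex and \<open>dv\<close> for the second. The remaining partial derivatives arise by
  permuting the arguments.\<close>

definition cos_form_du :: "real \<Rightarrow> real \<Rightarrow> real \<Rightarrow> real \<Rightarrow> real \<Rightarrow> real \<Rightarrow> real \<Rightarrow> real \<Rightarrow> real \<Rightarrow> real" where
  "cos_form_du k x X y Y z Z a b = 2 * x * (x * X) * Y * Z + (k * x\<^sup>2) * Y * x * z * b + X * Y * (x * X) * z * b
     + (k * x\<^sup>2) * Z * x * y * a + X * Z * (x * X) * y * a + 2 * k * x * (x * X) * y * z * a * b"

definition cos_form_dv :: "real \<Rightarrow> real \<Rightarrow> real \<Rightarrow> real \<Rightarrow> real \<Rightarrow> real \<Rightarrow> real \<Rightarrow> real \<Rightarrow> real \<Rightarrow> real \<Rightarrow> real" where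
  "cos_form_dv k x X y Y z Z a b c = x\<^sup>2 * (k * y\<^sup>2) * Z + X * (k * y\<^sup>2) * x * z * b + X * Z * x * (y * Y) * a
     + k * x\<^sup>2 * (y * Y) * z * a * b - y * Y * z * c"

definition edge_form_dv :: "real \<Rightarrow> real \<Rightarrow> real \<Rightarrow> real \<Rightarrow> real \<Rightarrow> real \<Rightarrow> real" where
  "edge_form_dv k x X y Y a = 2 * (y * (y * Y) + X * (k * y\<^sup>2) * x * y * a + X * Y * x * (y * Y) * a
     + k * x\<^sup>2 * y * (y * Y) * (1 + a\<^sup>2))"

text \<open>The full numerator \<open>N' * S - N * S' / 2\<close> in the coordinate of the angle's
  own vertex. In \<open>angle_num_v\<close> one edge form is already cancelled and the sign
  reversed, hence the extra edge forms wherever the two are combined.\<close>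

definition angle_num_u :: "real \<Rightarrow> real \<Rightarrow> real \<Rightarrow> real \<Rightarrow> real \<Rightarrow> real \<Rightarrow> real \<Rightarrow> real \<Rightarrow> real \<Rightarrow> real \<Rightarrow> real" where
  "angle_num_u k x X y Y z Z a b c =
     cos_form_du k x X y Y z Z a b * (edge_form k x X y Y a * edge_form k x X z Z b)
     - cos_form k x X y Y z Z a b c * (edge_form_dv k y Y x X a * edge_form k x X z Z b + edge_form k x X y Y a * edge_form_dv k z Z x X b) / 2"

definition angle_num_v :: "real \<Rightarrow> real \<Rightarrow> real \<Rightarrow> real \<Rightarrow> real \<Rightarrow> real \<Rightarrow> real \<Rightarrow> real \<Rightarrow> real \<Rightarrow> real" where
  "angle_num_v x X y Y z Z a b c =
     x * y * (x * Y * z * (c + a * b) + x * y * Z * (1 - a\<^sup>2) + y * z * X * (b + a * c))"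

lemma angle_num_v_eq:
  fixes k :: real
  assumes "X\<^sup>2 = 1 + k * x\<^sup>2" "Y\<^sup>2 = 1 + k * y\<^sup>2"
  shows "cos_form_dv k x X y Y z Z a b c * edge_form k x X y Y a - cos_form k x X y Y z Z a b c * edge_form_dv k x X y Y a / 2
    = - angle_num_v x X y Y z Z a b c"
proof -
  have h: "n * (2 * m) / 2 = n * m" for n m :: real by simp
  show ?thesis
    using cos_form_quotient_dv[OF assms, of Z z b a c] unfolding cos_form_dv_def edge_form_dv_def angle_num_v_def h .
qed

text \<open>In Euclidean geometry equality holds, since scaling all radii preserves the angles. In
  hyperbolic geometry the claim reduces to \<open>row_numerator_nonneg\<close> once the edge forms
  are written as \<open>A\<^sup>2 - 1\<close> and \<open>B\<^sup>2 - 1\<close>.\<close>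

lemma row_sum_numerator:
  fixes k :: real
  assumes k: "k = 0 \<and> X = 1 \<and> Y = 1 \<and> Z = 1 \<or> k = 1"
    and rel: "X\<^sup>2 = 1 + k * x\<^sup>2" "Y\<^sup>2 = 1 + k * y\<^sup>2" "Z\<^sup>2 = 1 + k * z\<^sup>2"
    and pos: "x > 0" "y > 0" "z > 0" "X \<ge> 1" "Y \<ge> 1" "Z \<ge> 1"
    and c: "0 \<le> a" "a \<le> 1" "0 \<le> b" "b \<le> 1" "0 \<le> c" "c \<le> 1"
  shows "angle_num_u k x X y Y z Z a b c \<ge>
     angle_num_v x X y Y z Z a b c * edge_form k x X z Z b + angle_num_v x X z Z y Y b a c * edge_form k x X y Y a"
  using k
proof
  assume "k = 0 \<and> X = 1 \<and> Y = 1 \<and> Z = 1"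
  then have "k = 0" "X = 1" "Y = 1" "Z = 1" by auto
  have "2 * angle_num_u k x X y Y z Z a b c =
     2 * (cos_form_du k x X y Y z Z a b * (edge_form k x X y Y a * edge_form k x X z Z b))
     - cos_form k x X y Y z Z a b c * (edge_form_dv k y Y x X a * edge_form k x X z Z b + edge_form k x X y Y a * edge_form_dv k z Z x X b)"
    by (simp add: angle_num_u_def right_diff_distrib)
  also have "\<dots> = 2 * (angle_num_v x X y Y z Z a b c * edge_form k x X z Z b + angle_num_v x X z Z y Y b a c * edge_form k x X y Y a)"
    unfolding angle_num_v_def edge_form_def cos_form_def cos_form_du_def edge_form_dv_def \<open>k = 0\<close> \<open>X = 1\<close> \<open>Y = 1\<close> \<open>Z = 1\<close> by algebra
  finally show ?thesis
    unfolding mult_cancel_left by simp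
next
  assume k: "k = 1"
  note rel' = rel[unfolded k mult_1]
  define A where "A = X * Y + x * y * a"
  define B where "B = X * Z + x * z * b"
  define C where "C = Y * Z + y * z * c"
  let ?N = "cos_form 1 x X y Y z Z a b c"
  let ?M = "edge_form 1 x X y Y a" and ?M' = "edge_form 1 x X z Z b"
  have M: "?M = A\<^sup>2 - 1" and M': "?M' = B\<^sup>2 - 1" and N: "?N = A * B - C"
    using rel' unfolding edge_form_def cos_form_def A_def B_def C_def by algebra+
  \<comment> \<open>The left-hand side is the derivative of \<open>A\<close> when both coordinates
    grow at unit speed. The three identities after it are the resulting derivatives of
    \<open>A\<^sup>2 - 1\<close>, \<open>B\<^sup>2 - 1\<close> and \<open>A * B - C\<close>.\<close>
  have EA: "x * (x * Y + X * y * a) + y * (X * y + x * Y * a) = (X + Y) * (A - 1)"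
    using rel' unfolding A_def by algebra
  have EM: "edge_form_dv 1 y Y x X a + edge_form_dv 1 x X y Y a = 2 * ((X + Y) * (A - 1) * A)"
    using rel' unfolding edge_form_dv_def A_def by algebra
  have EM': "edge_form_dv 1 z Z x X b + edge_form_dv 1 x X z Z b = 2 * ((X + Z) * (B - 1) * B)"
    using rel' unfolding edge_form_dv_def B_def by algebra
  have EN: "cos_form_du 1 x X y Y z Z a b + cos_form_dv 1 x X y Y z Z a b c + cos_form_dv 1 x X z Z y Y b a c
      = A * ((X + Z) * (B - 1)) + B * ((X + Y) * (A - 1)) - (Y + Z) * (C - 1)"
    using rel' unfolding cos_form_du_def cos_form_dv_def A_def B_def C_def by algebra
  have sym: "cos_form 1 x X z Z y Y b a c = ?N"
    unfolding cos_form_def by algebra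
  have P: "- angle_num_v x X y Y z Z a b c = cos_form_dv 1 x X y Y z Z a b c * ?M - ?N * edge_form_dv 1 x X y Y a / 2"
    using angle_num_v_eq[of X 1 x Y y z Z a b c] rel' by simp
  have P': "- angle_num_v x X z Z y Y b a c = cos_form_dv 1 x X z Z y Y b a c * ?M' - ?N * edge_form_dv 1 x X z Z b / 2"
    using angle_num_v_eq[of X 1 x Z z y Y b a c] rel' sym by simp
  have "angle_num_u 1 x X y Y z Z a b c - angle_num_v x X y Y z Z a b c * ?M' - angle_num_v x X z Z y Y b a c * ?M
    = (cos_form_du 1 x X y Y z Z a b + cos_form_dv 1 x X y Y z Z a b c + cos_form_dv 1 x X z Z y Y b a c) * (?M * ?M')
      - ?N * ((edge_form_dv 1 y Y x X a + edge_form_dv 1 x X y Y a) * ?M' + ?M * (edge_form_dv 1 z Z x X b + edge_form_dv 1 x X z Z b)) / 2"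
  proof -
    have "angle_num_u 1 x X y Y z Z a b c - angle_num_v x X y Y z Z a b c * ?M' - angle_num_v x X z Z y Y b a c * ?M
      = angle_num_u 1 x X y Y z Z a b c + (- angle_num_v x X y Y z Z a b c) * ?M' + (- angle_num_v x X z Z y Y b a c) * ?M"
      by simp
    then show ?thesis
      unfolding P P' angle_num_u_def by (simp add: algebra_simps add_divide_distrib)
  qed
  also have "\<dots> = (A * ((X + Z) * (B - 1)) + B * ((X + Y) * (A - 1)) - (Y + Z) * (C - 1)) * ((A\<^sup>2 - 1) * (B\<^sup>2 - 1))
      - (A * B - C) * ((X + Y) * (A - 1) * A * (B\<^sup>2 - 1) + (A\<^sup>2 - 1) * ((X + Z) * (B - 1) * B))"
    unfolding EM EM' EN M M' N by (simp add: field_simps)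
  also have "\<dots> \<ge> 0"
    by (rule row_numerator_nonneg[OF rel' pos c A_def B_def C_def])
  finally show ?thesis
    unfolding k by simp
qed

section \<open>Derivatives of a triangle angle in the u-coordinates\<close>

locale packing_profile =
  fixes k :: real and J :: "real set" and x X :: "real \<Rightarrow> real"
  assumes J_down: "u \<in> J \<Longrightarrow> v \<le> u \<Longrightarrow> v \<in> J"
    and k: "k = 0 \<and> (\<forall>u. X u = 1) \<or> k = 1"
    and rel: "u \<in> J \<Longrightarrow> (X u)\<^sup>2 = 1 + k * (x u)\<^sup>2"
    and x_pos: "u \<in> J \<Longrightarrow> x u > 0" and X_ge: "u \<in> J \<Longrightarrow> X u \<ge> 1"
    and der_x: "u \<in> J \<Longrightarrow> (x has_real_derivative x u * X u) (at u)"
    and der_X: "u \<in> J \<Longrightarrow> (X has_real_derivative k * (x u)\<^sup>2) (at u)"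
begin

definition edge_len where "edge_len u v a = edge_form k (x u) (X u) (x v) (X v) a"
definition cosine_num where "cosine_num u v w a b c = cos_form k (x u) (X u) (x v) (X v) (x w) (X w) a b c"
definition disc where "disc u v w a b c = edge_len u v a * edge_len u w b - (cosine_num u v w a b c)\<^sup>2"
definition tri_angle where "tri_angle u v w a b c = arccos (cosine_num u v w a b c / sqrt (edge_len u v a * edge_len u w b))"
definition tri_angle_dv where "tri_angle_dv u v w a b c =
  angle_num_v (x u) (X u) (x v) (X v) (x w) (X w) a b c / (edge_len u v a * sqrt (disc u v w a b c))"
definition tri_angle_du where "tri_angle_du u v w a b c =
  - angle_num_u k (x u) (X u) (x v) (X v) (x w) (X w) a b c / (edge_len u v a * edge_len u w b * sqrt (disc u v w a b c))"

lemma k_nonneg: "k \<ge> 0"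
  using k by auto

lemma X_pos: "u \<in> J \<Longrightarrow> X u > 0"
  using X_ge by fastforce

lemma edge_len_pos: "u \<in> J \<Longrightarrow> v \<in> J \<Longrightarrow> 0 \<le> a \<Longrightarrow> edge_len u v a > 0"
  unfolding edge_len_def by (rule edge_form_pos) (auto simp: k_nonneg x_pos X_pos)

lemma cosine_num_swap: "cosine_num u v w a b c = cosine_num u w v b a c"
  unfolding cosine_num_def cos_form_def by simp

lemma disc_swap: "disc u v w a b c = disc u w v b a c"
  unfolding disc_def by (subst cosine_num_swap) (simp add: mult.commute)

lemma disc_positive:
  assumes "u \<in> J" "v \<in> J" "w \<in> J" "a \<in> {0..1}" "b \<in> {0..1}" "c \<in> {0..1}"
  shows "disc u v w a b c > 0"
  unfolding disc_def cosine_num_def edge_len_def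
  using disc_form_pos[OF rel[OF assms(1)] rel[OF assms(2)] rel[OF assms(3)] k_nonneg] assms x_pos X_pos by simp

lemma tri_angle_dv_nonneg:
  assumes "u \<in> J" "v \<in> J" "w \<in> J" "a \<in> {0..1}" "b \<in> {0..1}" "c \<in> {0..1}"
  shows "tri_angle_dv u v w a b c \<ge> 0"
proof -
  have "a\<^sup>2 \<le> 1" using assms by (simp add: power_le_one)
  then show ?thesis
    unfolding tri_angle_dv_def angle_num_v_def
    using assms x_pos[of u] x_pos[of v] x_pos[of w] X_pos[of u] X_pos[of v] X_pos[of w] edge_len_pos[of u v a] disc_positive[of u v w a b c]
    by (intro divide_nonneg_nonneg mult_nonneg_nonneg add_nonneg_nonneg) auto
qed

text \<open>The three nonnegative terms of the numerator vanish together only for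
  \<open>a = 1\<close> and \<open>b = c = 0\<close>: if \<open>a < 1\<close>, the term with
  \<open>1 - a\<^sup>2\<close> is positive, otherwise the one with \<open>c + a * b\<close>.\<close>

lemma tri_angle_dv_pos:
  assumes J: "u \<in> J" "v \<in> J" "w \<in> J" and "a \<in> {0..1}" "b \<in> {0..1}" "c \<in> {0..1}"
    and nondeg: "a < 1 \<or> b > 0 \<or> c > 0"
  shows "tri_angle_dv u v w a b c > 0"
proof -
  note pos = x_pos[OF J(1)] x_pos[OF J(2)] x_pos[OF J(3)] X_pos[OF J(1)] X_pos[OF J(2)] X_pos[OF J(3)]
  have sq: "a\<^sup>2 \<le> 1" using assms by (simp add: power_le_one)
  have cosine_num: "x u * X v * x w * (c + a * b) \<ge> 0" "x u * x v * X w * (1 - a\<^sup>2) \<ge> 0" "x v * x w * X u * (b + a * c) \<ge> 0"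
    using pos assms sq by (auto intro!: mult_nonneg_nonneg)
  have "x u * X v * x w * (c + a * b) + x u * x v * X w * (1 - a\<^sup>2) + x v * x w * X u * (b + a * c) > 0"
  proof (cases "a < 1")
    case True
    then have "a\<^sup>2 < 1" using assms by (simp add: power_less_one_iff abs_square_less_1)
    then have "x u * x v * X w * (1 - a\<^sup>2) > 0" using pos by simp
    with cosine_num show ?thesis by linarith
  next
    case False
    then have "a = 1" using assms by simp
    then have "x u * X v * x w * (c + a * b) > 0" using pos assms by (auto simp: zero_less_mult_iff)
    with cosine_num show ?thesis by linarith
  qed
  then show ?thesis
    unfolding tri_angle_dv_def angle_num_v_def
    using pos edge_len_pos[of u v a] disc_positive[of u v w a b c] assms by simp
qed

lemma tri_angle_row_sum:
  assumes J: "u \<in> J" "v \<in> J" "w \<in> J" and abc: "a \<in> {0..1}" "b \<in> {0..1}" "c \<in> {0..1}"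
  shows "tri_angle_du u v w a b c + tri_angle_dv u v w a b c + tri_angle_dv u w v b a c \<le> 0"
proof -
  have mp: "edge_len u v a > 0" "edge_len u w b > 0" "sqrt (disc u v w a b c) > 0"
    using edge_len_pos disc_positive assms by auto
  have "angle_num_u k (x u) (X u) (x v) (X v) (x w) (X w) a b c \<ge>
     angle_num_v (x u) (X u) (x v) (X v) (x w) (X w) a b c * edge_len u w b +
     angle_num_v (x u) (X u) (x w) (X w) (x v) (X v) b a c * edge_len u v a"
    unfolding edge_len_def
    by (rule row_sum_numerator) (use k rel x_pos X_ge assms in auto)
  then have "(angle_num_v (x u) (X u) (x v) (X v) (x w) (X w) a b c * edge_len u w b +
     angle_num_v (x u) (X u) (x w) (X w) (x v) (X v) b a c * edge_len u v a
     - angle_num_u k (x u) (X u) (x v) (X v) (x w) (X w) a b c) / (edge_len u v a * edge_len u w b * sqrt (disc u v w a b c)) \<le> 0"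
    using mp by (intro divide_nonpos_pos) auto
  also have "(angle_num_v (x u) (X u) (x v) (X v) (x w) (X w) a b c * edge_len u w b +
     angle_num_v (x u) (X u) (x w) (X w) (x v) (X v) b a c * edge_len u v a
     - angle_num_u k (x u) (X u) (x v) (X v) (x w) (X w) a b c) / (edge_len u v a * edge_len u w b * sqrt (disc u v w a b c))
     = tri_angle_du u v w a b c + tri_angle_dv u v w a b c + tri_angle_dv u w v b a c"
    unfolding tri_angle_du_def tri_angle_dv_def disc_swap[of u w v b a c] using mp
    by (simp add: add_divide_distrib diff_divide_distrib)
  finally show ?thesis .
qed

text \<open>A chain rule along curves with arbitrary speeds, which is the form needed on segments.
  \<open>disc_positive\<close> keeps the cosine strictly between -1 and 1, where
  \<open>arccos\<close> is differentiable.\<close>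

lemma DERIV_tri_angle:
  assumes du: "(u has_real_derivative p) (at s)" and dv: "(v has_real_derivative q) (at s)"
    and dw: "(w has_real_derivative r) (at s)"
    and J: "u s \<in> J" "v s \<in> J" "w s \<in> J" and abc: "a \<in> {0..1}" "b \<in> {0..1}" "c \<in> {0..1}"
  shows "((\<lambda>s. tri_angle (u s) (v s) (w s) a b c) has_real_derivative
     tri_angle_du (u s) (v s) (w s) a b c * p + tri_angle_dv (u s) (v s) (w s) a b c * q + tri_angle_dv (u s) (w s) (v s) b a c * r) (at s)"
proof -
  note dx = DERIV_chain2[OF der_x[OF J(1)] du] DERIV_chain2[OF der_x[OF J(2)] dv] DERIV_chain2[OF der_x[OF J(3)] dw]
  note dX = DERIV_chain2[OF der_X[OF J(1)] du] DERIV_chain2[OF der_X[OF J(2)] dv] DERIV_chain2[OF der_X[OF J(3)] dw]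
  let ?xu = "x (u s)" and ?Xu = "X (u s)" and ?xv = "x (v s)" and ?Xv = "X (v s)" and ?xw = "x (w s)" and ?Xw = "X (w s)"
  have dM: "((\<lambda>s. edge_len (u s) (v s) a) has_real_derivative
      edge_form_dv k ?xv ?Xv ?xu ?Xu a * p + edge_form_dv k ?xu ?Xu ?xv ?Xv a * q) (at s)"
    unfolding edge_len_def edge_form_def edge_form_dv_def
    by (rule derivative_eq_intros dx dX refl)+ (simp add: algebra_simps power2_eq_square)
  have dM': "((\<lambda>s. edge_len (u s) (w s) b) has_real_derivative
      edge_form_dv k ?xw ?Xw ?xu ?Xu b * p + edge_form_dv k ?xu ?Xu ?xw ?Xw b * r) (at s)"
    unfolding edge_len_def edge_form_def edge_form_dv_def
    by (rule derivative_eq_intros dx dX refl)+ (simp add: algebra_simps power2_eq_square)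
  have dN: "((\<lambda>s. cosine_num (u s) (v s) (w s) a b c) has_real_derivative
      cos_form_du k ?xu ?Xu ?xv ?Xv ?xw ?Xw a b * p + cos_form_dv k ?xu ?Xu ?xv ?Xv ?xw ?Xw a b c * q
        + cos_form_dv k ?xu ?Xu ?xw ?Xw ?xv ?Xv b a c * r) (at s)"
    unfolding cosine_num_def cos_form_def cos_form_du_def cos_form_dv_def
    by (rule derivative_eq_intros dx dX refl)+ (simp add: algebra_simps power2_eq_square)
  define M where "M = edge_len (u s) (v s) a"
  define M' where "M' = edge_len (u s) (w s) b"
  define N where "N = cosine_num (u s) (v s) (w s) a b c"
  define d where "d = disc (u s) (v s) (w s) a b c"
  have pos: "M > 0" "M' > 0" "d > 0"
    unfolding M_def M'_def d_def using edge_len_pos disc_positive J abc by auto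
  have d_eq: "d = M * M' - N\<^sup>2"
    by (simp add: d_def disc_def M_def M'_def N_def)
  have S: "((\<lambda>s. edge_len (u s) (v s) a * edge_len (u s) (w s) b) has_real_derivative
      (edge_form_dv k ?xv ?Xv ?xu ?Xu a * p + edge_form_dv k ?xu ?Xu ?xv ?Xv a * q) * M'
        + M * (edge_form_dv k ?xw ?Xw ?xu ?Xu b * p + edge_form_dv k ?xu ?Xu ?xw ?Xw b * r)) (at s)"
    unfolding M_def M'_def by (rule derivative_eq_intros dM dM' refl)+ (simp add: algebra_simps)
  have P: "- angle_num_v ?xu ?Xu ?xv ?Xv ?xw ?Xw a b c =
      cos_form_dv k ?xu ?Xu ?xv ?Xv ?xw ?Xw a b c * M - N * edge_form_dv k ?xu ?Xu ?xv ?Xv a / 2"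
    unfolding M_def N_def edge_len_def cosine_num_def using angle_num_v_eq[OF rel[OF J(1)] rel[OF J(2)]] by simp
  have N': "N = cosine_num (u s) (w s) (v s) b a c"
    unfolding N_def by (rule cosine_num_swap)
  have P': "- angle_num_v ?xu ?Xu ?xw ?Xw ?xv ?Xv b a c =
      cos_form_dv k ?xu ?Xu ?xw ?Xw ?xv ?Xv b a c * M' - N * edge_form_dv k ?xu ?Xu ?xw ?Xw b / 2"
    unfolding M'_def N' edge_len_def cosine_num_def using angle_num_v_eq[OF rel[OF J(1)] rel[OF J(3)]] by simp
  have Q: "angle_num_u k ?xu ?Xu ?xv ?Xv ?xw ?Xw a b c =
      cos_form_du k ?xu ?Xu ?xv ?Xv ?xw ?Xw a b * (M * M') - N * (edge_form_dv k ?xv ?Xv ?xu ?Xu a * M' + M * edge_form_dv k ?xw ?Xw ?xu ?Xu b) / 2"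
    unfolding angle_num_u_def M_def M'_def N_def edge_len_def cosine_num_def by simp
  have num: "(cos_form_du k ?xu ?Xu ?xv ?Xv ?xw ?Xw a b * p + cos_form_dv k ?xu ?Xu ?xv ?Xv ?xw ?Xw a b c * q
        + cos_form_dv k ?xu ?Xu ?xw ?Xw ?xv ?Xv b a c * r) * (M * M')
      - N * ((edge_form_dv k ?xv ?Xv ?xu ?Xu a * p + edge_form_dv k ?xu ?Xu ?xv ?Xv a * q) * M'
        + M * (edge_form_dv k ?xw ?Xw ?xu ?Xu b * p + edge_form_dv k ?xu ?Xu ?xw ?Xw b * r)) / 2
      = angle_num_u k ?xu ?Xu ?xv ?Xv ?xw ?Xw a b c * p + (- angle_num_v ?xu ?Xu ?xv ?Xv ?xw ?Xw a b c) * M' * q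
        + (- angle_num_v ?xu ?Xu ?xw ?Xw ?xv ?Xv b a c) * M * r"
    unfolding P P' Q by (simp add: field_simps)
  have "((\<lambda>s. tri_angle (u s) (v s) (w s) a b c) has_real_derivative
     - (angle_num_u k ?xu ?Xu ?xv ?Xv ?xw ?Xw a b c * p + (- angle_num_v ?xu ?Xu ?xv ?Xv ?xw ?Xw a b c) * M' * q
        + (- angle_num_v ?xu ?Xu ?xw ?Xw ?xv ?Xv b a c) * M * r) / (M * M' * sqrt d)) (at s)"
    using DERIV_arccos_quotient_sqrt[OF dN S, folded M_def M'_def N_def, folded d_eq, unfolded num] pos
    by (simp add: tri_angle_def d_eq)
  moreover have "- (angle_num_u k ?xu ?Xu ?xv ?Xv ?xw ?Xw a b c * p + (- angle_num_v ?xu ?Xu ?xv ?Xv ?xw ?Xw a b c) * M' * q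
        + (- angle_num_v ?xu ?Xu ?xw ?Xw ?xv ?Xv b a c) * M * r) / (M * M' * sqrt d)
     = tri_angle_du (u s) (v s) (w s) a b c * p + tri_angle_dv (u s) (v s) (w s) a b c * q + tri_angle_dv (u s) (w s) (v s) b a c * r"
    unfolding tri_angle_du_def tri_angle_dv_def disc_swap[of _ "w s" "v s"] M_def[symmetric] M'_def[symmetric] d_def[symmetric]
    using pos by (simp add: field_simps)
  ultimately show ?thesis by simp
qed

lemma
  fixes u v w :: "'a::topological_space \<Rightarrow> real"
  assumes cont: "continuous_on S u" "continuous_on S v" "continuous_on S w"
    and J: "\<And>s. s \<in> S \<Longrightarrow> u s \<in> J" "\<And>s. s \<in> S \<Longrightarrow> v s \<in> J" "\<And>s. s \<in> S \<Longrightarrow> w s \<in> J"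
    and abc: "a \<in> {0..1}" "b \<in> {0..1}" "c \<in> {0..1}"
  shows continuous_on_tri_angle_dv: "continuous_on S (\<lambda>s. tri_angle_dv (u s) (v s) (w s) a b c)"
    and continuous_on_tri_angle_du: "continuous_on S (\<lambda>s. tri_angle_du (u s) (v s) (w s) a b c)"
proof -
  have x: "continuous_on J x" "continuous_on J X"
    using der_x der_X by (auto intro!: DERIV_continuous_on intro: DERIV_subset)
  have comp: "continuous_on S (\<lambda>s. x (u s))" "continuous_on S (\<lambda>s. x (v s))" "continuous_on S (\<lambda>s. x (w s))"
    "continuous_on S (\<lambda>s. X (u s))" "continuous_on S (\<lambda>s. X (v s))" "continuous_on S (\<lambda>s. X (w s))"
    using cont J by (auto intro!: continuous_on_compose2[OF x(1)] continuous_on_compose2[OF x(2)])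
  have edge_len: "continuous_on S (\<lambda>s. edge_len (u s) (v s) a)" "continuous_on S (\<lambda>s. edge_len (u s) (w s) b)"
    unfolding edge_len_def edge_form_def by (intro continuous_intros comp)+
  have cosine_num: "continuous_on S (\<lambda>s. cosine_num (u s) (v s) (w s) a b c)"
    unfolding cosine_num_def cos_form_def by (intro continuous_intros comp)
  have disc: "continuous_on S (\<lambda>s. sqrt (disc (u s) (v s) (w s) a b c))"
    unfolding disc_def by (intro continuous_intros edge_len cosine_num)
  have ne: "edge_len (u s) (v s) a \<noteq> 0" "edge_len (u s) (w s) b \<noteq> 0" "sqrt (disc (u s) (v s) (w s) a b c) \<noteq> 0" if "s \<in> S" for s
    using edge_len_pos[of "u s" "v s" a] edge_len_pos[of "u s" "w s" b] disc_positive[of "u s" "v s" "w s" a b c] J[OF that] abc by auto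
  show "continuous_on S (\<lambda>s. tri_angle_dv (u s) (v s) (w s) a b c)"
    unfolding tri_angle_dv_def by (intro continuous_on_divide continuous_on_mult edge_len disc)
      (use ne in \<open>auto simp: angle_num_v_def intro!: continuous_intros comp\<close>)
  show "continuous_on S (\<lambda>s. tri_angle_du (u s) (v s) (w s) a b c)"
    unfolding tri_angle_du_def by (intro continuous_on_divide continuous_on_mult edge_len disc)
      (use ne in \<open>auto simp: angle_num_u_def cos_form_du_def cos_form_def edge_form_def edge_form_dv_def intro!: continuous_intros comp\<close>)
qed

end

section \<open>Branched curvature flows\<close>

text \<open>The boundary of a face is a simple closed path with three edges. Enclosed orders only
  enlarge the right-hand side of the branch condition, so \<open>3 * pi\<close> minus the three
  weights exceeds \<open>2 * pi\<close>.\<close>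

lemma face_angle_sum_less_pi:
  assumes surf: "closed_connected_triangulated_surface F" and branch: "branch_structure F \<Phi> \<beta>"
    and f: "{i, j, k} \<in> F" and dist: "i \<noteq> j" "i \<noteq> k" "j \<noteq> k"
  shows "\<Phi> {i, j} + \<Phi> {i, k} + \<Phi> {j, k} < pi"
proof -
  have edges: "{i, j} \<in> edges F" "{j, k} \<in> edges F" "{k, i} \<in> edges F"
    using f dist unfolding edges_def by (auto intro!: bexI[OF _ f])
  have path: "path_edges [i, j, k] = {{i, j}, {j, k}, {k, i}}"
  proof -
    have len: "length [i, j, k] = 3"
      by simp
    have "path_edges [i, j, k] = (\<lambda>n. {[i, j, k] ! n, [i, j, k] ! (Suc n mod 3)}) ` {n. n < 3}"
      unfolding path_edges_def len by (rule setcompr_eq_image)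
    moreover have "{n. n < 3} = {0, 1, 2::nat}"
      by auto
    moreover have "Suc 0 mod 3 = 1" "Suc 1 mod 3 = 2" "Suc 2 mod 3 = 0" "[i, j, k] ! 2 = k"
      by simp_all
    ultimately show ?thesis
      by (simp only: image_insert image_empty nth_Cons_0 One_nat_def nth_Cons_Suc)
  qed
  have "simple_closed_path F [i, j, k]"
    using edges dist path by (simp add: simple_closed_path_def)
  then have less: "2 * (real (\<Sum>v\<in>enclosed F [i, j, k]. \<beta> v) + 1) * pi < (\<Sum>e\<in>path_edges [i, j, k]. pi - \<Phi> e)"
    using branch unfolding branch_structure_def by blast
  have "2 * pi \<le> 2 * (real (\<Sum>v\<in>enclosed F [i, j, k]. \<beta> v) + 1) * pi"
    by (intro mult_right_mono) (auto intro: sum_nonneg)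
  also note less
  also have "(\<Sum>e\<in>path_edges [i, j, k]. pi - \<Phi> e) = 3 * pi - (\<Phi> {i, j} + \<Phi> {i, k} + \<Phi> {j, k})"
  proof -
    have "{i, j} \<noteq> {j, k}" "{i, j} \<noteq> {k, i}" "{j, k} \<noteq> {k, i}"
      using dist by (auto simp: doubleton_eq_iff)
    then show ?thesis
      unfolding path by (simp add: insert_commute)
  qed
  finally show ?thesis
    by linarith
qed

lemma cos_weight:
  assumes "weight F \<Phi>" "e \<in> edges F"
  shows "cos (\<Phi> e) \<in> {0..1}"
proof -
  have "0 \<le> \<Phi> e" "\<Phi> e \<le> pi / 2"
    using assms by (auto simp: weight_def)
  then show ?thesis
    using cos_ge_zero[of "\<Phi> e"] by simp
qed

text \<open>
  If \<open>\<Phi>\<^sub>i\<^sub>j = 0\<close> and \<open>\<Phi>\<^sub>i\<^sub>k = \<Phi>\<^sub>j\<^sub>k = \<pi> / 2\<close>, the angle at \<open>i\<close> does not depend on \<open>r\<^sub>j\<close>. The branch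
  condition for the boundary of a face excludes exactly this case.
\<close>

lemma cos_weight_nondegenerate:
  assumes w: "weight F \<Phi>" and e: "e1 \<in> edges F" "e2 \<in> edges F" "e3 \<in> edges F"
    and less: "\<Phi> e1 + \<Phi> e2 + \<Phi> e3 < pi"
  shows "cos (\<Phi> e1) < 1 \<or> cos (\<Phi> e2) > 0 \<or> cos (\<Phi> e3) > 0"
proof (rule ccontr)
  assume neg: "\<not> ?thesis"
  have range: "0 \<le> \<Phi> e" "\<Phi> e \<le> pi / 2" if "e \<in> {e1, e2, e3}" for e
    using w e that by (auto simp: weight_def)
  have "\<Phi> e \<ge> pi / 2" if "e \<in> {e2, e3}" for e
  proof (rule ccontr)
    assume "\<not> ?thesis"
    then have "cos (\<Phi> e) > 0"
      using range[of e] that by (intro cos_gt_zero_pi) auto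
    then show False using neg that by auto
  qed
  then have "\<Phi> e2 \<ge> pi / 2" "\<Phi> e3 \<ge> pi / 2" by auto
  then show False
    using less range[of e1] by simp
qed

text \<open>\<open>\<phi>\<close> maps radii to \<open>u\<close> and \<open>\<psi>\<close> is its
  inverse. The uniform smallness in \<open>large\<close> cannot hold in Euclidean geometry, where
  scaling all radii preserves the angles; there the alternative \<open>J = UNIV\<close>
  applies.\<close>

locale radius_coordinate = packing_profile +
  fixes \<phi> \<psi> :: "real \<Rightarrow> real"
  assumes \<phi>_J: "r > 0 \<Longrightarrow> \<phi> r \<in> J" and \<psi>_\<phi>: "r > 0 \<Longrightarrow> \<psi> (\<phi> r) = r"
    and \<psi>_pos: "u \<in> J \<Longrightarrow> \<psi> u > 0" and \<phi>_\<psi>: "u \<in> J \<Longrightarrow> \<phi> (\<psi> u) = u"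
    and der_\<psi>: "u \<in> J \<Longrightarrow> (\<psi> has_real_derivative x u) (at u)"
    and large: "J = UNIV \<or> (\<forall>\<epsilon>>0. \<forall>s\<in>J. \<exists>h\<in>J. s \<le> h \<and>
      (\<forall>v\<in>J. \<forall>w\<in>J. \<forall>a\<in>{0..1}. \<forall>b\<in>{0..1}. \<forall>c\<in>{0..1}. tri_angle h v w a b c \<le> \<epsilon>))"

text \<open>The identification of \<open>\<theta>\<close> with \<open>tri_angle\<close> is demanded
  on faces only, because the weights are constrained only on edges.\<close>

locale branched_packing_flow = radius_coordinate +
  fixes F :: "'v::finite set set" and \<Phi> :: "'v set \<Rightarrow> real" and \<beta> :: "'v \<Rightarrow> nat"
    and \<alpha> :: real and R :: "'v \<Rightarrow> real" and \<theta> :: "real ^ 'v \<Rightarrow> 'v \<Rightarrow> 'v \<Rightarrow> 'v \<Rightarrow> real"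
    and rbar :: "real ^ 'v"
  assumes surf: "closed_connected_triangulated_surface F" and weight: "weight F \<Phi>"
    and branch: "branch_structure F \<Phi> \<beta>" and \<alpha>: "\<alpha> \<ge> 0" and R: "R i \<le> 0"
    and nontriv: "\<not> (\<forall>i. \<alpha> * R i = 0)"
    and angle: "circle_packing_metric r \<Longrightarrow> {i, j, l} \<in> F \<Longrightarrow> i \<noteq> j \<Longrightarrow> i \<noteq> l \<Longrightarrow> j \<noteq> l \<Longrightarrow>
      \<theta> r i j l = tri_angle (\<phi> (r $ i)) (\<phi> (r $ j)) (\<phi> (r $ l)) (cos (\<Phi> {i, j})) (cos (\<Phi> {i, l})) (cos (\<Phi> {j, l}))"
    and angle_commute: "\<theta> r i j l = \<theta> r i l j"
    and rbar: "circle_packing_metric rbar"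
    and rbar_eq: "R i * exp (\<alpha> * \<phi> (rbar $ i)) =
      2 * pi - (\<Sum>f\<in>{f\<in>F. i \<in> f}. inner_angle (\<theta> rbar) f i) + 2 * pi * real (\<beta> i)"
begin

section \<open>The vector field in u-coordinates and its Jacobian\<close>

definition K :: "real ^ 'v \<Rightarrow> 'v \<Rightarrow> real" where
  "K r i = 2 * pi - (\<Sum>f\<in>{f\<in>F. i \<in> f}. inner_angle (\<theta> r) f i)"

text \<open>Faces are unordered, whereas \<open>tri_angle\<close> takes its neighbours in order.
  Fixing one order for each vertex and face gives a single expression to differentiate; the angle
  itself does not depend on the choice.\<close>

definition others :: "'v \<Rightarrow> 'v set \<Rightarrow> 'v \<times> 'v" where
  "others i f = (SOME (j, l). f = {i, j, l} \<and> i \<noteq> j \<and> i \<noteq> l \<and> j \<noteq> l)"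

abbreviation nb1 where "nb1 i f \<equiv> fst (others i f)"
abbreviation nb2 where "nb2 i f \<equiv> snd (others i f)"

lemma others:
  assumes "f \<in> F" "i \<in> f"
  shows "f = {i, nb1 i f, nb2 i f}" "i \<noteq> nb1 i f" "i \<noteq> nb2 i f" "nb1 i f \<noteq> nb2 i f"
proof -
  have "card f = 3"
    using surf assms by (auto simp: closed_connected_triangulated_surface_def)
  then have "card (f - {i}) = 2"
    using assms by simp
  then obtain j l where "f - {i} = {j, l}" "j \<noteq> l"
    unfolding card_2_iff by blast
  then have "f = {i, j, l} \<and> i \<noteq> j \<and> i \<noteq> l \<and> j \<noteq> l"
    using assms by blast
  then have "\<exists>jk. case jk of (j, l) \<Rightarrow> f = {i, j, l} \<and> i \<noteq> j \<and> i \<noteq> l \<and> j \<noteq> l"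
    by blast
  from someI_ex[OF this] have "f = {i, nb1 i f, nb2 i f} \<and> i \<noteq> nb1 i f \<and> i \<noteq> nb2 i f \<and> nb1 i f \<noteq> nb2 i f"
    unfolding others_def case_prod_unfold .
  then show "f = {i, nb1 i f, nb2 i f}" "i \<noteq> nb1 i f" "i \<noteq> nb2 i f" "nb1 i f \<noteq> nb2 i f"
    by blast+
qed

lemma others_mem:
  assumes "f \<in> F" "i \<in> f"
  shows "nb1 i f \<in> f" "nb2 i f \<in> f"
  using others(1)[OF assms] by blast+

lemma face_edges:
  assumes "f \<in> F" "i \<in> f"
  shows "{i, nb1 i f} \<in> edges F" "{i, nb2 i f} \<in> edges F" "{nb1 i f, nb2 i f} \<in> edges F"
proof -
  have "e \<subseteq> f \<Longrightarrow> card e = 2 \<Longrightarrow> e \<in> edges F" for e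
    using assms by (auto simp: edges_def)
  then show "{i, nb1 i f} \<in> edges F" "{i, nb2 i f} \<in> edges F" "{nb1 i f, nb2 i f} \<in> edges F"
    using others(2-4)[OF assms] others_mem[OF assms] assms(2) by simp_all
qed

abbreviation cos1 where "cos1 i f \<equiv> cos (\<Phi> {i, nb1 i f})"
abbreviation cos2 where "cos2 i f \<equiv> cos (\<Phi> {i, nb2 i f})"
abbreviation cos3 where "cos3 i f \<equiv> cos (\<Phi> {nb1 i f, nb2 i f})"

lemma cos_range:
  assumes "f \<in> F" "i \<in> f"
  shows "cos1 i f \<in> {0..1}" "cos2 i f \<in> {0..1}" "cos3 i f \<in> {0..1}"
  using face_edges[OF assms] cos_weight[OF weight] by blast+

definition face_angle :: "'v \<Rightarrow> 'v set \<Rightarrow> real ^ 'v \<Rightarrow> real" where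
  "face_angle i f u = tri_angle (u $ i) (u $ nb1 i f) (u $ nb2 i f) (cos1 i f) (cos2 i f) (cos3 i f)"

definition face_angle_d0 where "face_angle_d0 i f u = tri_angle_du (u $ i) (u $ nb1 i f) (u $ nb2 i f) (cos1 i f) (cos2 i f) (cos3 i f)"
definition face_angle_d1 where "face_angle_d1 i f u = tri_angle_dv (u $ i) (u $ nb1 i f) (u $ nb2 i f) (cos1 i f) (cos2 i f) (cos3 i f)"
definition face_angle_d2 where "face_angle_d2 i f u = tri_angle_dv (u $ i) (u $ nb2 i f) (u $ nb1 i f) (cos2 i f) (cos1 i f) (cos3 i f)"

definition face_angle_d :: "'v \<Rightarrow> 'v set \<Rightarrow> 'v \<Rightarrow> real ^ 'v \<Rightarrow> real" where
  "face_angle_d i f l u = (if l = i then face_angle_d0 i f u else 0) + (if l = nb1 i f then face_angle_d1 i f u else 0)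
     + (if l = nb2 i f then face_angle_d2 i f u else 0)"

definition curvature :: "'v \<Rightarrow> real ^ 'v \<Rightarrow> real" where
  "curvature i u = 2 * pi - (\<Sum>f\<in>{f\<in>F. i \<in> f}. face_angle i f u)"

definition velocity :: "'v \<Rightarrow> real ^ 'v \<Rightarrow> real" where
  "velocity i u = R i * exp (\<alpha> * u $ i) - (curvature i u + 2 * pi * real (\<beta> i))"

definition jacobian :: "'v \<Rightarrow> 'v \<Rightarrow> real ^ 'v \<Rightarrow> real" where
  "jacobian i l u = (if l = i then \<alpha> * R i * exp (\<alpha> * u $ i) else 0) + (\<Sum>f\<in>{f\<in>F. i \<in> f}. face_angle_d i f l u)"

definition U :: "real ^ 'v \<Rightarrow> real ^ 'v" where "U r = (\<chi> i. \<phi> (r $ i))"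
definition \<Psi> :: "real ^ 'v \<Rightarrow> real ^ 'v" where "\<Psi> u = (\<chi> i. \<psi> (u $ i))"

lemma U_cube: "circle_packing_metric r \<Longrightarrow> U r \<in> cube J"
  by (auto simp: U_def cube_def circle_packing_metric_def \<phi>_J)

lemma \<Psi>_metric: "u \<in> cube J \<Longrightarrow> circle_packing_metric (\<Psi> u)"
  by (auto simp: \<Psi>_def cube_def circle_packing_metric_def \<psi>_pos)

lemma U_\<Psi>: "u \<in> cube J \<Longrightarrow> U (\<Psi> u) = u"
  by (auto simp: U_def \<Psi>_def cube_def vec_eq_iff \<phi>_\<psi>)

lemma \<Psi>_U: "circle_packing_metric r \<Longrightarrow> \<Psi> (U r) = r"
  by (auto simp: U_def \<Psi>_def circle_packing_metric_def vec_eq_iff \<psi>_\<phi>)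

lemma K_eq_curvature:
  assumes "circle_packing_metric r"
  shows "K r i = curvature i (U r)"
proof -
  have "inner_angle (\<theta> r) f i = face_angle i f (U r)" if f: "f \<in> F" "i \<in> f" for f
  proof -
    note o = others(2-4)[OF f] others(1)[OF f, symmetric]
    have "inner_angle (\<theta> r) {i, nb1 i f, nb2 i f} i = \<theta> r i (nb1 i f) (nb2 i f)"
      by (rule inner_angle_eq[where \<theta> = "\<theta> r", OF angle_commute]) (use o(1-3) in simp)
    then show ?thesis
      using angle[OF assms, of i "nb1 i f" "nb2 i f"] f by (simp add: o face_angle_def U_def)
  qed
  then show ?thesis
    unfolding K_def curvature_def by (intro arg_cong2[of _ _ _ _ minus] sum.cong) auto
qed

lemma sum_face_angle_d: "(\<Sum>l\<in>UNIV. face_angle_d i f l u * h l) = face_angle_d0 i f u * h i + face_angle_d1 i f u * h (nb1 i f) + face_angle_d2 i f u * h (nb2 i f)"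
proof -
  have "(\<Sum>l\<in>UNIV. face_angle_d i f l u * h l) = (\<Sum>l\<in>UNIV. (if l = i then face_angle_d0 i f u * h l else 0)
      + (if l = nb1 i f then face_angle_d1 i f u * h l else 0) + (if l = nb2 i f then face_angle_d2 i f u * h l else 0))"
    unfolding face_angle_d_def by (intro sum.cong) (auto simp: algebra_simps)
  then show ?thesis
    by (simp add: sum.distrib)
qed

lemma sum_jacobian: "(\<Sum>l\<in>UNIV. jacobian i l u * h l) = \<alpha> * R i * exp (\<alpha> * u $ i) * h i
    + (\<Sum>f\<in>{f\<in>F. i \<in> f}. face_angle_d0 i f u * h i + face_angle_d1 i f u * h (nb1 i f) + face_angle_d2 i f u * h (nb2 i f))"
proof -
  have "(\<Sum>l\<in>UNIV. jacobian i l u * h l) = (\<Sum>l\<in>UNIV. (if l = i then \<alpha> * R i * exp (\<alpha> * u $ i) * h l else 0))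
      + (\<Sum>l\<in>UNIV. \<Sum>f\<in>{f\<in>F. i \<in> f}. face_angle_d i f l u * h l)"
    unfolding sum.distrib[symmetric] jacobian_def
    by (intro sum.cong) (auto simp: distrib_right sum_distrib_right)
  then show ?thesis
    unfolding sum.swap[of _ _ UNIV] sum_face_angle_d by simp
qed

lemma DERIV_face_angle:
  assumes f: "f \<in> F" "i \<in> f" and u: "u + s *\<^sub>R h \<in> cube J"
  shows "((\<lambda>s. face_angle i f (u + s *\<^sub>R h)) has_real_derivative
    face_angle_d0 i f (u + s *\<^sub>R h) * h $ i + face_angle_d1 i f (u + s *\<^sub>R h) * h $ nb1 i f + face_angle_d2 i f (u + s *\<^sub>R h) * h $ nb2 i f) (at s)"
proof -
  have lin: "((\<lambda>s. (u + s *\<^sub>R h) $ j) has_real_derivative h $ j) (at s)" for j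
    by (auto intro!: derivative_eq_intros)
  show ?thesis
    unfolding face_angle_def face_angle_d0_def face_angle_d1_def face_angle_d2_def
    by (rule DERIV_tri_angle[OF lin lin lin]) (use u cos_range[OF f] in \<open>auto simp: cube_def\<close>)
qed

lemma DERIV_velocity:
  assumes "u + s *\<^sub>R h \<in> cube J"
  shows "((\<lambda>s. velocity i (u + s *\<^sub>R h)) has_real_derivative (\<Sum>l\<in>UNIV. jacobian i l (u + s *\<^sub>R h) * h $ l)) (at s)"
  unfolding velocity_def curvature_def sum_jacobian
  using DERIV_face_angle[OF _ _ assms]
  by (auto intro!: derivative_eq_intros simp: sum_negf)

lemma continuous_jacobian: "continuous_on (cube J) (jacobian i l)"
proof -
  have nth: "continuous_on (cube J) (\<lambda>u. u $ j)" for j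
    by (intro continuous_intros)
  have cond: "continuous_on (cube J) (\<lambda>u. if c then g u else 0)" if "continuous_on (cube J) g"
    for c and g :: "real ^ 'v \<Rightarrow> real"
    using that by (cases c) auto
  have "continuous_on (cube J) (face_angle_d i f l)" if f: "f \<in> F" "i \<in> f" for f
  proof -
    note range = cos_range[OF f]
    have "continuous_on (cube J) (face_angle_d0 i f)" "continuous_on (cube J) (face_angle_d1 i f)" "continuous_on (cube J) (face_angle_d2 i f)"
      unfolding face_angle_d0_def face_angle_d1_def face_angle_d2_def
      by (intro continuous_on_tri_angle_du continuous_on_tri_angle_dv nth range; auto simp: cube_def)+
    then show ?thesis
      unfolding face_angle_d_def by (intro continuous_on_add cond)
  qed
  then show ?thesis
    unfolding jacobian_def by (intro continuous_on_add continuous_on_sum cond continuous_intros) auto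
qed

lemma face_angle_d12_nonneg:
  assumes f: "f \<in> F" "i \<in> f" and u: "u \<in> cube J"
  shows "face_angle_d1 i f u \<ge> 0" "face_angle_d2 i f u \<ge> 0" "face_angle_d0 i f u + face_angle_d1 i f u + face_angle_d2 i f u \<le> 0"
  unfolding face_angle_d0_def face_angle_d1_def face_angle_d2_def
  using cos_range[OF f] u by (auto intro!: tri_angle_dv_nonneg tri_angle_row_sum simp: cube_def)

lemma face_angle_d12_pos:
  assumes f: "f \<in> F" "i \<in> f" and u: "u \<in> cube J"
  shows "face_angle_d1 i f u > 0" "face_angle_d2 i f u > 0"
proof -
  note o = others(2-4)[OF f] others(1)[OF f, symmetric] and e = face_edges[OF f]
  have "\<Phi> {i, nb1 i f} + \<Phi> {i, nb2 i f} + \<Phi> {nb1 i f, nb2 i f} < pi"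
    using face_angle_sum_less_pi[OF surf branch, of i "nb1 i f" "nb2 i f"] f by (simp add: o)
  then have "cos1 i f < 1 \<or> cos2 i f > 0 \<or> cos3 i f > 0" "cos2 i f < 1 \<or> cos1 i f > 0 \<or> cos3 i f > 0"
    by (intro cos_weight_nondegenerate[OF weight] e; simp add: add_ac)+
  then show "face_angle_d1 i f u > 0" "face_angle_d2 i f u > 0"
    unfolding face_angle_d1_def face_angle_d2_def
    using cos_range[OF f] u by (auto intro!: tri_angle_dv_pos simp: cube_def)
qed

lemma face_angle_d_nonneg: "f \<in> F \<Longrightarrow> i \<in> f \<Longrightarrow> u \<in> cube J \<Longrightarrow> i \<noteq> l \<Longrightarrow> face_angle_d i f l u \<ge> 0"
  using face_angle_d12_nonneg[of f i u] by (auto simp: face_angle_d_def)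

lemma jacobian_pos:
  assumes u: "u \<in> cube J" and e: "{i, l} \<in> edges F"
  shows "i \<noteq> l \<and> jacobian i l u > 0"
proof
  show ne: "i \<noteq> l"
    using e by (auto simp: edges_def)
  obtain f where f: "f \<in> F" "i \<in> f" "l \<in> f"
    using e by (auto simp: edges_def)
  have "l = nb1 i f \<or> l = nb2 i f"
    using others(1)[OF f(1,2)] f(3) ne by (metis insertE singletonD)
  then have "face_angle_d i f l u > 0"
    using face_angle_d12_pos[OF f(1,2) u] others(2-4)[OF f(1,2)] ne by (auto simp: face_angle_d_def)
  also have "face_angle_d i f l u \<le> (\<Sum>f\<in>{f\<in>F. i \<in> f}. face_angle_d i f l u)"
    using f face_angle_d_nonneg[OF _ _ u ne] by (intro member_le_sum) auto
  also have "\<dots> = jacobian i l u"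
    using ne by (simp add: jacobian_def)
  finally show "jacobian i l u > 0" .
qed

lemma row_sum_jacobian:
  assumes u: "u \<in> cube J"
  shows "(\<Sum>l\<in>UNIV. jacobian i l u) \<le> \<alpha> * R i * exp (\<alpha> * u $ i)"
proof -
  have "(\<Sum>l\<in>UNIV. jacobian i l u) = \<alpha> * R i * exp (\<alpha> * u $ i) + (\<Sum>f\<in>{f\<in>F. i \<in> f}. face_angle_d0 i f u + face_angle_d1 i f u + face_angle_d2 i f u)"
    using sum_jacobian[of i u "\<lambda>_. 1"] by simp
  moreover have "(\<Sum>f\<in>{f\<in>F. i \<in> f}. face_angle_d0 i f u + face_angle_d1 i f u + face_angle_d2 i f u) \<le> 0"
    using face_angle_d12_nonneg[OF _ _ u] by (intro sum_nonpos) auto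
  ultimately show ?thesis by simp
qed

text \<open>The corner is a constant vector \<open>h\<close> so large that each angle at a vertex
  with \<open>u $ i = h\<close> is at most \<open>\<epsilon>\<close>. At most \<open>card F\<close>
  such angles sum to at most \<open>2 * pi\<close>, so the curvature is nonnegative there and every
  term of the velocity is nonpositive.\<close>

lemma barrier_large:
  assumes J: "J \<noteq> UNIV" and u0: "u0 \<in> cube J" and e: "e \<in> cube J"
  shows "\<exists>hi\<in>cube J. (\<forall>i. u0 $ i \<le> hi $ i \<and> e $ i \<le> hi $ i) \<and>
    (\<forall>u\<in>cube J. \<forall>i. (\<forall>j. u $ j \<le> hi $ j) \<and> u $ i = hi $ i \<longrightarrow> velocity i u \<le> 0)"
proof -
  define s where "s = Max (range (\<lambda>i. max (u0 $ i) (e $ i)))"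
  have "s \<in> range (\<lambda>i. max (u0 $ i) (e $ i))"
    unfolding s_def by (intro Max_in) auto
  then have sJ: "s \<in> J"
    using u0 e by (auto simp: cube_def max_def)
  have s: "u0 $ i \<le> s" "e $ i \<le> s" for i
  proof -
    have "max (u0 $ i) (e $ i) \<le> s"
      unfolding s_def by (intro Max_ge) auto
    then show "u0 $ i \<le> s" "e $ i \<le> s" by auto
  qed
  define \<epsilon> where "\<epsilon> = 2 * pi / (1 + real (card F))"
  have \<epsilon>: "\<epsilon> > 0"
    unfolding \<epsilon>_def by (intro divide_pos_pos) auto
  obtain h where h: "h \<in> J" "s \<le> h" and tri_angle: "\<And>v w a b c. v \<in> J \<Longrightarrow> w \<in> J \<Longrightarrow> a \<in> {0..1} \<Longrightarrow> b \<in> {0..1} \<Longrightarrow> c \<in> {0..1} \<Longrightarrow>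
      tri_angle h v w a b c \<le> \<epsilon>"
    using large J \<epsilon> sJ by metis
  show ?thesis
  proof (intro bexI[of _ "\<chi> i. h"] conjI allI ballI impI)
    show "(\<chi> i. h) \<in> cube J" using h by (simp add: cube_def)
    show "u0 $ i \<le> (\<chi> i. h) $ i" "e $ i \<le> (\<chi> i. h) $ i" for i
      using s[of i] h by auto
    fix u :: "real ^ 'v" and i assume u: "u \<in> cube J" and "(\<forall>j. u $ j \<le> (\<chi> i. h) $ j) \<and> u $ i = (\<chi> i. h) $ i"
    then have ui: "u $ i = h" by simp
    have "(\<Sum>f\<in>{f\<in>F. i \<in> f}. face_angle i f u) \<le> (\<Sum>f\<in>{f\<in>F. i \<in> f}. \<epsilon>)"
    proof (rule sum_mono)
      fix f assume "f \<in> {f \<in> F. i \<in> f}"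
      then show "face_angle i f u \<le> \<epsilon>"
        using cos_range[of f i] u unfolding face_angle_def ui by (intro tri_angle) (auto simp: cube_def)
    qed
    also have "\<dots> \<le> real (card F) * \<epsilon>"
      using \<epsilon> by (auto intro!: mult_right_mono card_mono)
    also have "\<dots> \<le> 2 * pi"
      unfolding \<epsilon>_def by (simp add: field_simps)
    finally have "curvature i u \<ge> 0" by (simp add: curvature_def)
    moreover have "R i * exp (\<alpha> * u $ i) \<le> 0"
      using R by (simp add: mult_nonpos_nonneg)
    moreover have "2 * pi * real (\<beta> i) \<ge> 0" by simp
    ultimately show "velocity i u \<le> 0"
      unfolding velocity_def by linarith
  qed
qed

definition i0 where "i0 = (SOME i. \<alpha> * R i \<noteq> 0)"

lemma i0: "\<alpha> * R i0 < 0"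
proof -
  have "\<alpha> * R i0 \<noteq> 0"
    unfolding i0_def by (rule someI_ex) (use nontriv in blast)
  moreover have "\<alpha> * R i0 \<le> 0"
    using \<alpha> R by (simp add: mult_nonneg_nonpos)
  ultimately show ?thesis by linarith
qed

sublocale flow: cooperative_flow velocity jacobian J "{(i, j). {i, j} \<in> edges F}" i0 "U rbar"
proof
  show "v \<in> J" if "u \<in> J" "v \<le> u" for u v
    using that by (rule J_down)
  show "((\<lambda>s. velocity i (u + s *\<^sub>R h)) has_real_derivative (\<Sum>j\<in>UNIV. jacobian i j (u + s *\<^sub>R h) * h $ j)) (at s)"
    if "u + s *\<^sub>R h \<in> cube J" for u s h i
    using that by (rule DERIV_velocity)
  show "continuous_on (cube J) (jacobian i j)" for i j
    by (rule continuous_jacobian)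
  show "0 \<le> jacobian i j u" if "u \<in> cube J" "i \<noteq> j" for i j u
    using that face_angle_d_nonneg by (auto simp: jacobian_def intro!: sum_nonneg)
  show "i \<noteq> j \<and> 0 < jacobian i j u" if "u \<in> cube J" "(i, j) \<in> {(i, j). {i, j} \<in> edges F}" for i j u
    using that by (intro jacobian_pos) auto
  show "(i, j) \<in> {(i, j). {i, j} \<in> edges F}\<^sup>*" for i j
    using surf by (auto simp: closed_connected_triangulated_surface_def)
  show "(\<Sum>j\<in>UNIV. jacobian i j u) \<le> 0" if "u \<in> cube J" for i u
    by (rule order_trans[OF row_sum_jacobian[OF that]])
      (intro mult_nonpos_nonneg mult_nonneg_nonpos \<alpha> R exp_ge_zero)
  show "(\<Sum>j\<in>UNIV. jacobian i0 j u) < 0" if "u \<in> cube J" for u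
    by (rule order_le_less_trans[OF row_sum_jacobian[OF that]]) (intro mult_neg_pos i0 exp_gt_zero)
  show "U rbar \<in> cube J"
    using rbar by (rule U_cube)
  show "velocity i (U rbar) = 0" for i
    using rbar_eq[of i] K_eq_curvature[OF rbar, of i] by (simp add: velocity_def U_def K_def)
  show "J = UNIV \<or> (\<forall>u0\<in>cube J. \<exists>hi\<in>cube J. (\<forall>i. u0 $ i \<le> hi $ i \<and> U rbar $ i \<le> hi $ i) \<and>
      (\<forall>u\<in>cube J. \<forall>i. (\<forall>j. u $ j \<le> hi $ j) \<and> u $ i = hi $ i \<longrightarrow> velocity i u \<le> 0))"
    using barrier_large U_cube[OF rbar] by blast
qed

section \<open>Transfer from u-coordinates to radii\<close>

definition sol :: "real set \<Rightarrow> (real \<Rightarrow> real ^ 'v) \<Rightarrow> bool" where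
  "sol I r \<longleftrightarrow> (\<forall>t\<in>I. circle_packing_metric (r t) \<and>
     (\<forall>i. ((\<lambda>s. \<phi> (r s $ i)) has_real_derivative
        (R i * exp (\<alpha> * \<phi> (r t $ i)) - (K (r t) i + 2 * pi * real (\<beta> i)))) (at t within I)))"

lemma velocity_U: "circle_packing_metric r \<Longrightarrow>
    velocity i (U r) = R i * exp (\<alpha> * \<phi> (r $ i)) - (K r i + 2 * pi * real (\<beta> i))"
  using K_eq_curvature[of r i] by (simp add: velocity_def U_def)

lemma solution_of_sol: "sol I r \<Longrightarrow> flow.solution I (\<lambda>t. U (r t))"
  unfolding sol_def flow.solution_def using velocity_U U_cube by (auto simp: U_def)

lemma sol_of_solution:
  assumes u: "flow.solution I u"
  shows "sol I (\<lambda>t. \<Psi> (u t))"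
  unfolding sol_def
proof (intro ballI conjI allI)
  fix t i assume t: "t \<in> I"
  have cube: "u s \<in> cube J" if "s \<in> I" for s
    using u that by (auto simp: flow.solution_def)
  show m: "circle_packing_metric (\<Psi> (u t))"
    using cube[OF t] by (rule \<Psi>_metric)
  have "((\<lambda>s. u s $ i) has_real_derivative velocity i (u t)) (at t within I)"
    using u t by (auto simp: flow.solution_def)
  then have "((\<lambda>s. \<phi> (\<Psi> (u s) $ i)) has_real_derivative velocity i (u t)) (at t within I)"
    by (rule has_field_derivative_transform_within[OF _ zero_less_one t])
      (use cube \<phi>_\<psi> in \<open>auto simp: \<Psi>_def cube_def\<close>)
  also have "velocity i (u t) = velocity i (U (\<Psi> (u t)))"
    using U_\<Psi>[OF cube[OF t]] by simp
  finally show "((\<lambda>s. \<phi> (\<Psi> (u s) $ i)) has_real_derivative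
        (R i * exp (\<alpha> * \<phi> (\<Psi> (u t) $ i)) - (K (\<Psi> (u t)) i + 2 * pi * real (\<beta> i)))) (at t within I)"
    unfolding velocity_U[OF m] .
qed

theorem metric_unique:
  assumes r: "circle_packing_metric r" and "\<And>i. R i * exp (\<alpha> * \<phi> (r $ i)) = K r i + 2 * pi * real (\<beta> i)"
  shows "r = rbar"
proof -
  have "U r = U rbar"
    using assms by (intro flow.equilibrium_unique U_cube) (auto simp: velocity_U)
  then show ?thesis
    using \<Psi>_U[OF r] \<Psi>_U[OF rbar] by metis
qed

theorem solutions_exist: "solutions_exist_for_all_time sol"
  unfolding solutions_exist_for_all_time_def
proof (intro conjI allI impI)
  fix r0 :: "real ^ 'v" assume r0: "circle_packing_metric r0"
  then obtain u where "flow.solution {0..} u" "u 0 = U r0"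
    using flow.solution_exists U_cube by blast
  then show "\<exists>r. sol {0..} r \<and> r 0 = r0"
    using sol_of_solution \<Psi>_U[OF r0] by (intro exI[of _ "\<lambda>t. \<Psi> (u t)"]) simp
next
  fix T :: real and r assume "T > 0" and r: "sol {0..<T} r"
  then obtain u where u: "flow.solution {0..} u" "\<And>t. t \<in> {0..<T} \<Longrightarrow> u t = U (r t)"
    using flow.solution_extends[OF _ solution_of_sol] by metis
  have "\<Psi> (u t) = r t" if "t \<in> {0..<T}" for t
    using u(2)[OF that] r that by (auto simp: sol_def \<Psi>_U)
  then show "\<exists>r'. sol {0..} r' \<and> (\<forall>t\<in>{0..<T}. r' t = r t)"
    using sol_of_solution[OF u(1)] by blast
qed

text \<open>The derivative \<open>x\<close> of \<open>\<psi>\<close> is unbounded on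
  \<open>J\<close> but bounded on the compact intervals in which the trajectory is trapped, so
  exponential decay passes to the radii with the same rate.\<close>

theorem solutions_converge: "solutions_converge_exponentially sol rbar"
  unfolding solutions_converge_exponentially_def
proof (intro allI impI)
  fix r assume r: "sol {0..} r"
  obtain lo hi C c where hi: "hi \<in> cube J" and e: "U rbar \<in> flow.rect lo hi"
    and ub: "\<And>t. t \<ge> 0 \<Longrightarrow> U (r t) \<in> flow.rect lo hi" and C: "C > 0" "c > 0"
    and est: "\<And>t i. t \<ge> 0 \<Longrightarrow> \<bar>U (r t) $ i - U rbar $ i\<bar> \<le> C * exp (- c * t)"
    using flow.solution_converges[OF solution_of_sol[OF r]] by metis
  have sub: "{lo $ i..hi $ i} \<subseteq> J" for i
    using hi by (auto simp: cube_def intro: J_down[where u = "hi $ i"])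
  have "\<exists>L. \<forall>u\<in>{lo $ i..hi $ i}. \<bar>x u\<bar> \<le> L" for i
  proof -
    have "continuous_on {lo $ i..hi $ i} x"
      using sub by (intro DERIV_continuous_on[where D = "\<lambda>u. x u * X u"] has_field_derivative_at_within[OF der_x]) blast
    then have "compact (x ` {lo $ i..hi $ i})"
      by (intro compact_continuous_image) auto
    then show ?thesis
      using compact_imp_bounded by (fastforce simp: bounded_iff)
  qed
  then obtain L where L: "\<And>i u. u \<in> {lo $ i..hi $ i} \<Longrightarrow> \<bar>x u\<bar> \<le> L i"
    by metis
  have comp: "\<bar>r t $ i - rbar $ i\<bar> \<le> \<bar>L i\<bar> * (C * exp (- c * t))" if t: "t \<ge> 0" for t i
  proof -
    have m: "circle_packing_metric (r t)"
      using r t by (auto simp: sol_def)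
    have "norm (\<psi> (U (r t) $ i) - \<psi> (U rbar $ i)) \<le> \<bar>L i\<bar> * norm (U (r t) $ i - U rbar $ i)"
    proof (rule field_differentiable_bound[of "{lo $ i..hi $ i}" \<psi> x])
      show "(\<psi> has_field_derivative x z) (at z within {lo $ i..hi $ i})" if "z \<in> {lo $ i..hi $ i}" for z
        using sub that by (intro has_field_derivative_at_within[OF der_\<psi>]) blast
      show "norm (x z) \<le> \<bar>L i\<bar>" if "z \<in> {lo $ i..hi $ i}" for z
        using L[OF that] by simp
    qed (use ub[OF t] e in \<open>auto simp: flow.rect_def\<close>)
    also have "\<dots> \<le> \<bar>L i\<bar> * (C * exp (- c * t))"
      using est[OF t, of i] by (intro mult_left_mono) auto
    finally show ?thesis
      using m rbar by (simp add: U_def circle_packing_metric_def \<psi>_\<phi>)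
  qed
  define C' where "C' = 1 + (\<Sum>i\<in>UNIV. \<bar>L i\<bar>) * C"
  have "(\<Sum>i\<in>UNIV. \<bar>L i\<bar>) * C \<ge> 0"
    using C by (auto intro!: mult_nonneg_nonneg sum_nonneg)
  then have C': "C' > 0" "(\<Sum>i\<in>UNIV. \<bar>L i\<bar>) * C \<le> C'"
    by (auto simp: C'_def)
  have "norm (r t - rbar) \<le> C' * exp (- c * t)" if t: "t \<ge> 0" for t
  proof -
    have "norm (r t - rbar) \<le> (\<Sum>i\<in>UNIV. \<bar>(r t - rbar) $ i\<bar>)"
      by (rule norm_le_l1_cart)
    also have "\<dots> \<le> (\<Sum>i\<in>UNIV. \<bar>L i\<bar> * (C * exp (- c * t)))"
      using comp[OF t] by (intro sum_mono) simp
    also have "\<dots> = ((\<Sum>i\<in>UNIV. \<bar>L i\<bar>) * C) * exp (- c * t)"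
      by (simp add: sum_distrib_right mult.assoc)
    also have "\<dots> \<le> C' * exp (- c * t)"
      using C' by (intro mult_right_mono) auto
    finally show ?thesis .
  qed
  then show "\<exists>C>0. \<exists>c>0. \<forall>t\<ge>0. norm (r t - rbar) \<le> C * exp (- c * t)"
    using C' C by blast
qed

end

section \<open>Euclidean and hyperbolic background geometry\<close>

lemma tanh_artanh_exp:
  fixes u :: real
  assumes "u < 0"
  shows "tanh (artanh (exp u)) = exp u"
proof -
  have t: "0 < exp u" "exp u < 1"
    using assms by auto
  then have "exp (- 2 * artanh (exp u)) = (1 - exp u) / (1 + exp u)"
    unfolding artanh_def by (simp add: exp_minus add_pos_pos)
  moreover have "1 - (1 - exp u) / (1 + exp u) = 2 * exp u / (1 + exp u)"
    "1 + (1 - exp u) / (1 + exp u) = 2 / (1 + exp u)"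
    using add_pos_pos[OF zero_less_one t(1)] by (simp_all add: field_simps)
  moreover have "1 + exp u \<noteq> 0"
    using t by linarith
  ultimately show ?thesis
    unfolding tanh_real_altdef by simp
qed

lemma artanh_exp_pos:
  fixes u :: real
  assumes "u < 0"
  shows "artanh (exp u) > 0"
proof (rule ccontr)
  assume "\<not> ?thesis"
  then have "tanh (artanh (exp u)) \<le> 0"
    by (simp add: not_less)
  then show False
    using tanh_artanh_exp[OF assms] by (simp add: not_le[symmetric] del: not_le)
qed

text \<open>With \<open>s = sinh (r / 2)\<close> and \<open>c = cosh (r / 2)\<close> the coordinate
  is \<open>ln (s / c)\<close>, so its \<open>sinh\<close> is
  \<open>(s / c - c / s) / 2 = - 1 / (2 * s * c)\<close>, and \<open>2 * s * c = sinh r\<close>. The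
  \<open>cosh\<close> is treated in the same way.\<close>

lemma
  fixes r :: real
  assumes "r > 0"
  shows u_H_neg: "u_H r < 0"
    and sinh_u_H: "- 1 / sinh (u_H r) = sinh r"
    and cosh_u_H: "- cosh (u_H r) / sinh (u_H r) = cosh r"
proof -
  define s where "s = sinh (r / 2)"
  define c where "c = cosh (r / 2)"
  have c: "c\<^sup>2 = s\<^sup>2 + 1"
    unfolding s_def c_def by (rule cosh_square_eq)
  have pos: "s > 0" "c > 0"
    unfolding s_def c_def using assms by auto
  have t: "tanh (r / 2) = s / c"
    unfolding tanh_def s_def c_def by simp
  have sq: "s * s + 1 = c * c"
    using c by (simp add: power2_eq_square)
  have r: "sinh r = 2 * s * c" "cosh r = s\<^sup>2 + c\<^sup>2"
    using sinh_double[of "r / 2"] cosh_double[of "r / 2"] by (simp_all add: s_def c_def)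
  show "u_H r < 0"
    unfolding u_H_def using assms tanh_real_lt_1[of "r / 2"] by (simp add: ln_less_zero)
  have sh: "sinh (u_H r) = - 1 / (2 * s * c)"
  proof -
    have "sinh (u_H r) = (s / c - c / s) / 2"
      unfolding u_H_def t using pos by (subst sinh_ln_real) auto
    also have "\<dots> = (s * s - c * c) / (2 * s * c)"
      using pos by (simp add: field_simps)
    also have "s * s - c * c = - 1"
      using sq by simp
    finally show ?thesis by simp
  qed
  have ch: "cosh (u_H r) = (s\<^sup>2 + c\<^sup>2) / (2 * s * c)"
  proof -
    have "cosh (u_H r) = (s / c + c / s) / 2"
      unfolding u_H_def t using pos by (subst cosh_ln_real) auto
    then show ?thesis
      using pos by (simp add: field_simps power2_eq_square)
  qed
  show "- 1 / sinh (u_H r) = sinh r"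
    unfolding sh r using pos by simp
  show "- cosh (u_H r) / sinh (u_H r) = cosh r"
    unfolding sh ch r using pos by simp
qed

interpretation Euc: packing_profile 0 UNIV exp "\<lambda>_. 1"
  by unfold_locales (auto intro!: derivative_eq_intros)

interpretation Euc: radius_coordinate 0 UNIV exp "\<lambda>_. 1" u_E exp
  by unfold_locales (auto simp: u_E_def)

text \<open>\<open>xH\<close> and \<open>XH\<close> are \<open>sinh r\<close> and
  \<open>cosh r\<close> expressed in \<open>u\<close>, by \<open>sinh_u_H\<close> and
  \<open>cosh_u_H\<close>.\<close>

abbreviation xH :: "real \<Rightarrow> real" where "xH u \<equiv> - 1 / sinh u"
abbreviation XH :: "real \<Rightarrow> real" where "XH u \<equiv> - cosh u / sinh u"

lemma XH_ge:
  assumes "u < 0"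
  shows "XH u \<ge> 1"
proof -
  have "cosh u + sinh u > 0"
    by (simp add: cosh_plus_sinh)
  then show ?thesis
    using assms by (simp add: field_simps)
qed

interpretation Hyp: packing_profile 1 "{..<0}" xH XH
proof
  show "1 = (0::real) \<and> (\<forall>u. XH u = 1) \<or> 1 = (1::real)" by simp
  fix u :: real assume "u \<in> {..<0}"
  then have u: "sinh u < 0" "u < 0" by auto
  show "(XH u)\<^sup>2 = 1 + 1 * (xH u)\<^sup>2"
    using u cosh_square_eq[of u] by (simp add: power_divide field_simps)
  show "xH u > 0" using u by (simp add: divide_neg_neg)
  show "XH u \<ge> 1" using u by (rule_tac XH_ge)
  show "(xH has_real_derivative xH u * XH u) (at u)"
    using u by (auto intro!: derivative_eq_intros simp: field_simps power2_eq_square)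
  show "(XH has_real_derivative 1 * (xH u)\<^sup>2) (at u)"
    using u cosh_square_eq[of u]
    by (auto intro!: derivative_eq_intros simp: power_divide field_simps power2_eq_square)
qed auto

lemma Hyp_edge_len:
  assumes "u < 0" "v < 0"
  shows "Hyp.edge_len u v a = (XH u * XH v + xH u * xH v * a)\<^sup>2 - 1"
proof -
  have "(XH u)\<^sup>2 = 1 + 1 * (xH u)\<^sup>2" "(XH v)\<^sup>2 = 1 + 1 * (xH v)\<^sup>2"
    using Hyp.rel assms by auto
  then show ?thesis
    unfolding Hyp.edge_len_def edge_form_def by algebra
qed

lemma Hyp_cosine_num:
  assumes "u < 0"
  shows "Hyp.cosine_num u v w a b c = (XH u * XH v + xH u * xH v * a) * (XH u * XH w + xH u * xH w * b)
    - (XH v * XH w + xH v * xH w * c)"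
proof -
  have "(XH u)\<^sup>2 = 1 + 1 * (xH u)\<^sup>2"
    using Hyp.rel assms by auto
  then show ?thesis
    unfolding Hyp.cosine_num_def cos_form_def by algebra
qed

text \<open>With \<open>A\<close>, \<open>B\<close>, \<open>C\<close> the hyperbolic cosines of the
  edge lengths, \<open>A * B\<close> is at least \<open>X\<^sup>2 * Y * Z\<close> while
  \<open>C\<close> is at most \<open>2 * Y * Z\<close>. The denominator in the law of cosines is at
  most \<open>A * B\<close>, so the cosine is at least \<open>1 - 2 / X\<^sup>2\<close>, whatever
  the other two radii are.\<close>

lemma Hyp_tri_angle_le:
  assumes uvw: "u < 0" "v < 0" "w < 0" and abc: "a \<in> {0..1}" "b \<in> {0..1}" "c \<in> {0..1}"
    and \<epsilon>: "0 \<le> \<epsilon>" "\<epsilon> \<le> pi" and small: "2 / (XH u)\<^sup>2 \<le> 1" "2 / (XH u)\<^sup>2 \<le> 1 - cos \<epsilon>"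
  shows "Hyp.tri_angle u v w a b c \<le> \<epsilon>"
proof -
  define X where "X = XH u" define Y where "Y = XH v" define Z where "Z = XH w"
  define x where "x = xH u" define y where "y = xH v" define z where "z = xH w"
  have ge: "X \<ge> 1" "Y \<ge> 1" "Z \<ge> 1"
    unfolding X_def Y_def Z_def by (fact XH_ge[OF uvw(1)] XH_ge[OF uvw(2)] XH_ge[OF uvw(3)])+
  have pos: "x > 0" "y > 0" "z > 0"
    unfolding x_def y_def z_def by (rule Hyp.x_pos, use uvw in simp)+
  have rel: "Y\<^sup>2 = 1 + y\<^sup>2" "Z\<^sup>2 = 1 + z\<^sup>2"
    unfolding Y_def Z_def y_def z_def
    by (rule Hyp.rel[unfolded mult_1], use uvw in simp)+
  have "y \<le> Y" "z \<le> Z"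
    by (rule power2_le_imp_le; use rel ge in linarith)+
  define A where "A = X * Y + x * y * a"
  define B where "B = X * Z + x * z * b"
  define C where "C = Y * Z + y * z * c"
  have "A \<ge> X * Y" "B \<ge> X * Z"
    unfolding A_def B_def using pos abc by auto
  have XY: "X * Y \<ge> 1" "X * Z \<ge> 1"
    using mult_mono[of 1 X 1 Y] mult_mono[of 1 X 1 Z] ge by auto
  have AB: "A \<ge> 1" "B \<ge> 1"
    using XY \<open>A \<ge> X * Y\<close> \<open>B \<ge> X * Z\<close> by auto
  have AB_ge: "A * B \<ge> (X * Y) * (X * Z)"
    using \<open>A \<ge> X * Y\<close> \<open>B \<ge> X * Z\<close> XY AB by (intro mult_mono) auto
  have "y * z * c \<le> Y * Z * 1"
    using \<open>y \<le> Y\<close> \<open>z \<le> Z\<close> pos abc ge by (intro mult_mono) auto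
  then have "C \<le> 2 * (Y * Z)"
    by (simp add: C_def)
  also have "2 * (Y * Z) = 2 / X\<^sup>2 * ((X * Y) * (X * Z))"
    using ge by (simp add: field_simps power2_eq_square)
  also have "\<dots> \<le> 2 / X\<^sup>2 * (A * B)"
    using AB_ge by (intro mult_left_mono) auto
  finally have "A * B - C \<ge> (1 - 2 / X\<^sup>2) * (A * B)"
    by (simp add: algebra_simps)
  \<comment> \<open>This makes the numerator nonnegative; only then does replacing the denominator
    \<open>A * B\<close> by the smaller \<open>sqrt S\<close> not lower the quotient.\<close>
  moreover have "(1 - 2 / X\<^sup>2) * (A * B) \<ge> 0"
    using small(1) AB by (intro mult_nonneg_nonneg) (auto simp: X_def)
  ultimately have num: "A * B - C \<ge> (1 - 2 / X\<^sup>2) * (A * B)" "A * B - C \<ge> 0"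
    by auto
  define S where "S = (A\<^sup>2 - 1) * (B\<^sup>2 - 1)"
  have edge_len: "Hyp.edge_len u v a = A\<^sup>2 - 1" "Hyp.edge_len u w b = B\<^sup>2 - 1"
    unfolding A_def B_def X_def Y_def Z_def x_def y_def z_def
    using Hyp_edge_len uvw by auto
  have cosine_num: "Hyp.cosine_num u v w a b c = A * B - C"
    unfolding A_def B_def C_def X_def Y_def Z_def x_def y_def z_def
    using Hyp_cosine_num uvw by auto
  have disc: "(A * B - C)\<^sup>2 < S"
  proof -
    have "Hyp.disc u v w a b c > 0"
      by (rule Hyp.disc_positive) (use uvw abc in simp_all)
    then show ?thesis
      unfolding Hyp.disc_def edge_len cosine_num S_def by simp
  qed
  have S: "S > 0"
    using disc zero_le_power2[of "A * B - C"] by linarith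
  have "S \<le> (A * B)\<^sup>2"
    unfolding S_def power_mult_distrib using AB by (intro mult_mono) (auto simp: one_le_power)
  then have S_le: "sqrt S \<le> A * B"
    using AB by (intro real_le_lsqrt) auto
  have "cos \<epsilon> \<le> 1 - 2 / X\<^sup>2"
    using small(2) by (simp add: X_def)
  also have "\<dots> \<le> (A * B - C) / (A * B)"
    using num(1) AB by (simp add: pos_le_divide_eq)
  also have "\<dots> \<le> (A * B - C) / sqrt S"
    using S_le num(2) S by (intro divide_left_mono) (use AB in auto)
  finally have lower: "cos \<epsilon> \<le> (A * B - C) / sqrt S" .
  have upper: "(A * B - C) / sqrt S \<le> 1"
    using S disc real_le_rsqrt[of "A * B - C" S] by (simp add: pos_divide_le_eq)
  have "arccos ((A * B - C) / sqrt S) \<le> arccos (cos \<epsilon>)"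
    using lower upper by (intro arccos_le_arccos) auto
  then show ?thesis
    unfolding Hyp.tri_angle_def edge_len cosine_num S_def[symmetric] using \<epsilon> by (simp add: arccos_cos)
qed

lemma Hyp_tri_angle_small:
  assumes "\<epsilon> > 0" "s < 0"
  shows "\<exists>h\<in>{..<0}. s \<le> h \<and>
    (\<forall>v\<in>{..<0}. \<forall>w\<in>{..<0}. \<forall>a\<in>{0..1}. \<forall>b\<in>{0..1}. \<forall>c\<in>{0..1}. Hyp.tri_angle h v w a b c \<le> \<epsilon>)"
proof -
  \<comment> \<open>The cap at \<open>pi\<close> keeps
    \<open>arccos (cos \<epsilon>') = \<epsilon>'\<close>.\<close>
  define \<epsilon>' where "\<epsilon>' = min \<epsilon> pi"
  have \<epsilon>': "0 < \<epsilon>'" "\<epsilon>' \<le> pi" "\<epsilon>' \<le> \<epsilon>"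
    using assms by (auto simp: \<epsilon>'_def)
  define \<eta> where "\<eta> = min 1 (1 - cos \<epsilon>')"
  have "cos \<epsilon>' < cos 0"
    using \<epsilon>' by (intro cos_monotone_0_pi) auto
  then have \<eta>: "\<eta> > 0" "\<eta> \<le> 1" "\<eta> \<le> 1 - cos \<epsilon>'"
    by (auto simp: \<eta>_def)
  \<comment> \<open>Infinite radius is \<open>u = 0\<close> approached from the left, and
    \<open>2 / (XH u)\<^sup>2\<close> is at most \<open>2 * (sinh u)\<^sup>2\<close>.\<close>
  have "((\<lambda>u::real. 2 * (sinh u)\<^sup>2) \<longlongrightarrow> 2 * (sinh 0)\<^sup>2) (at_left 0)"
    by (intro tendsto_intros)
  then have "\<forall>\<^sub>F u in at_left (0::real). 2 * (sinh u)\<^sup>2 < \<eta>"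
    using \<eta> by (intro order_tendstoD) auto
  moreover have "\<forall>\<^sub>F u in at_left (0::real). s < u"
    using assms by (intro eventually_at_leftI[of s]) auto
  moreover have "\<forall>\<^sub>F u in at_left (0::real). u < 0"
    by (intro eventually_at_leftI[of "-1"]) auto
  ultimately have "\<forall>\<^sub>F u in at_left (0::real). 2 * (sinh u)\<^sup>2 < \<eta> \<and> s < u \<and> u < 0"
    by eventually_elim auto
  then obtain h where h: "2 * (sinh h)\<^sup>2 < \<eta>" "s < h" "h < 0"
    using eventually_happens trivial_limit_at_left_real by (metis (mono_tags, lifting))
  have "2 / (XH h)\<^sup>2 = 2 * (sinh h)\<^sup>2 / (cosh h)\<^sup>2"
    by (simp add: power_divide)
  also have "\<dots> \<le> 2 * (sinh h)\<^sup>2 / 1"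
    using cosh_real_ge_1[of h] by (intro divide_left_mono) (auto simp: one_le_power)
  finally have X_small: "2 / (XH h)\<^sup>2 \<le> \<eta>"
    using h(1) by simp
  have "Hyp.tri_angle h v w a b c \<le> \<epsilon>'" if "v < 0" "w < 0" "a \<in> {0..1}" "b \<in> {0..1}" "c \<in> {0..1}" for v w a b c
    by (rule Hyp_tri_angle_le[OF h(3) that]) (use X_small \<eta> \<epsilon>' in linarith)+
  then have "Hyp.tri_angle h v w a b c \<le> \<epsilon>" if "v < 0" "w < 0" "a \<in> {0..1}" "b \<in> {0..1}" "c \<in> {0..1}" for v w a b c
    using that \<epsilon>'(3) by (meson order_trans)
  then show ?thesis
    using h(2,3) by (intro bexI[of _ h] conjI ballI) simp_all
qed

interpretation Hyp: radius_coordinate 1 "{..<0}" xH XH u_H "\<lambda>u. 2 * artanh (exp u)"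
proof
  show "u_H r \<in> {..<0}" if "r > 0" for r
    using u_H_neg[OF that] by simp
  show "2 * artanh (exp (u_H r)) = r" if "r > 0" for r
    using that unfolding u_H_def by (simp add: artanh_tanh_real)
  show "{..<0::real} = UNIV \<or> (\<forall>\<epsilon>>0. \<forall>s\<in>{..<0}. \<exists>h\<in>{..<0}. s \<le> h \<and>
      (\<forall>v\<in>{..<0}. \<forall>w\<in>{..<0}. \<forall>a\<in>{0..1}. \<forall>b\<in>{0..1}. \<forall>c\<in>{0..1}. Hyp.tri_angle h v w a b c \<le> \<epsilon>))"
    using Hyp_tri_angle_small by blast
  fix u :: real assume "u \<in> {..<0}"
  then have u: "u < 0" by simp
  show "0 < 2 * artanh (exp u)"
    using artanh_exp_pos[OF u] by simp
  show "u_H (2 * artanh (exp u)) = u"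
    unfolding u_H_def by (simp add: tanh_artanh_exp[OF u])
  have "- 1 / sinh u = 2 * exp u / (1 - (exp u)\<^sup>2)"
  proof -
    have "sinh u = (exp u - inverse (exp u)) / 2"
      using sinh_ln_real[of "exp u"] by simp
    also have "\<dots> = - (1 - (exp u)\<^sup>2) / (2 * exp u)"
      by (simp add: field_simps power2_eq_square)
    finally have sinh: "sinh u = - (1 - (exp u)\<^sup>2) / (2 * exp u)" .
    have "- 1 / (- p / q) = q / p" for p q :: real
      by simp
    then show ?thesis
      unfolding sinh .
  qed
  moreover have "\<bar>exp u\<bar> < 1" using u by simp
  from DERIV_cmult[OF DERIV_chain2[OF artanh_real_has_field_derivative[OF this] DERIV_exp], of 2]
  have "((\<lambda>u. 2 * artanh (exp u)) has_real_derivative 2 * exp u / (1 - (exp u)\<^sup>2)) (at u)"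
    by simp
  ultimately show "((\<lambda>u. 2 * artanh (exp u)) has_real_derivative - 1 / sinh u) (at u)"
    by simp
qed

section \<open>The two laws of cosines in the common form\<close>

lemma angle_E_eq_tri_angle:
  assumes r: "circle_packing_metric r"
    and "0 \<le> cos (\<Phi> {i, j})" "0 \<le> cos (\<Phi> {i, k})" "0 \<le> cos (\<Phi> {j, k})"
  shows "angle_E (length_E \<Phi> r) i j k = Euc.tri_angle (u_E (r $ i)) (u_E (r $ j)) (u_E (r $ k))
    (cos (\<Phi> {i, j})) (cos (\<Phi> {i, k})) (cos (\<Phi> {j, k}))"
proof -
  have len: "length_E \<Phi> r l m = sqrt (Euc.edge_len (u_E (r $ l)) (u_E (r $ m)) (cos (\<Phi> {l, m})))" for l m
    using r unfolding length_E_def Euc.edge_len_def edge_form_def by (simp add: u_E_def circle_packing_metric_def)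
  have edge_len: "Euc.edge_len (u_E (r $ i)) (u_E (r $ j)) (cos (\<Phi> {i, j})) > 0"
    "Euc.edge_len (u_E (r $ i)) (u_E (r $ k)) (cos (\<Phi> {i, k})) > 0"
    "Euc.edge_len (u_E (r $ j)) (u_E (r $ k)) (cos (\<Phi> {j, k})) > 0"
    using assms by (auto intro!: Euc.edge_len_pos)
  have "Euc.edge_len (u_E (r $ i)) (u_E (r $ j)) (cos (\<Phi> {i, j})) + Euc.edge_len (u_E (r $ i)) (u_E (r $ k)) (cos (\<Phi> {i, k}))
      - Euc.edge_len (u_E (r $ j)) (u_E (r $ k)) (cos (\<Phi> {j, k}))
    = 2 * Euc.cosine_num (u_E (r $ i)) (u_E (r $ j)) (u_E (r $ k)) (cos (\<Phi> {i, j})) (cos (\<Phi> {i, k})) (cos (\<Phi> {j, k}))"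
    unfolding Euc.edge_len_def Euc.cosine_num_def edge_form_def cos_form_def by (simp add: algebra_simps)
  then show ?thesis
    unfolding angle_E_def Euc.tri_angle_def len using edge_len by (simp add: real_sqrt_mult mult.assoc)
qed

lemma angle_H_eq_tri_angle:
  assumes r: "circle_packing_metric r"
    and c: "0 \<le> cos (\<Phi> {i, j})" "0 \<le> cos (\<Phi> {i, k})" "0 \<le> cos (\<Phi> {j, k})"
  shows "angle_H (length_H \<Phi> r) i j k = Hyp.tri_angle (u_H (r $ i)) (u_H (r $ j)) (u_H (r $ k))
    (cos (\<Phi> {i, j})) (cos (\<Phi> {i, k})) (cos (\<Phi> {j, k}))"
proof -
  have pos: "r $ l > 0" for l
    using r by (auto simp: circle_packing_metric_def)
  note XH = cosh_u_H[OF pos] and xH = sinh_u_H[OF pos] and neg = u_H_neg[OF pos]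
  define A where "A l m = cosh (r $ l) * cosh (r $ m) + sinh (r $ l) * sinh (r $ m) * cos (\<Phi> {l, m})" for l m
  \<comment> \<open>From 1 upwards \<open>arcosh\<close> inverts \<open>cosh\<close>, so that
    \<open>A l m\<close> really is the \<open>cosh\<close> of the length.\<close>
  have A_ge: "A l m \<ge> 1" if "0 \<le> cos (\<Phi> {l, m})" for l m
  proof -
    have "1 * 1 \<le> cosh (r $ l) * cosh (r $ m)"
      by (intro mult_mono) (auto simp: cosh_real_ge_1)
    moreover have "0 \<le> sinh (r $ l) * sinh (r $ m) * cos (\<Phi> {l, m})"
      by (intro mult_nonneg_nonneg that) (use pos in \<open>auto intro: less_imp_le\<close>)
    ultimately show ?thesis unfolding A_def by linarith
  qed
  have len: "length_H \<Phi> r l m = arcosh (A l m)" for l m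
    by (simp add: length_H_def A_def)
  have edge_len: "Hyp.edge_len (u_H (r $ l)) (u_H (r $ m)) (cos (\<Phi> {l, m})) = (A l m)\<^sup>2 - 1" for l m
    unfolding Hyp_edge_len[OF neg neg] XH xH A_def ..
  have cosine_num: "Hyp.cosine_num (u_H (r $ i)) (u_H (r $ j)) (u_H (r $ k)) (cos (\<Phi> {i, j})) (cos (\<Phi> {i, k})) (cos (\<Phi> {j, k}))
     = A i j * A i k - A j k"
    unfolding Hyp_cosine_num[OF neg] XH xH A_def ..
  show ?thesis
    unfolding angle_H_def Hyp.tri_angle_def len edge_len cosine_num
    using A_ge[OF c(1)] A_ge[OF c(2)] A_ge[OF c(3)] by (simp add: sinh_arcosh_real real_sqrt_mult)
qed

theorem theorem6p1:
  fixes F :: "'v::finite set set" and \<Phi> :: "'v set \<Rightarrow> real" and \<beta> :: "'v \<Rightarrow> nat"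
    and \<alpha> :: real and R :: "'v \<Rightarrow> real" and rE rH :: "real ^ 'v"
  assumes "closed_connected_triangulated_surface F"
    and "weight F \<Phi>"
    and "branch_structure F \<Phi> \<beta>"
    and "\<alpha> \<ge> 0"
    and "\<forall>i. R i \<le> 0"
    and "\<not> (\<forall>i. \<alpha> * R i = 0)"
    and "admissible_by_E F \<Phi> \<beta> \<alpha> R rE"
    and "tanh_admissible_by_H F \<Phi> \<beta> \<alpha> R rH"
  shows "(\<forall>r. circle_packing_metric r \<and> (\<forall>i. branched_curvature_E F \<Phi> \<beta> \<alpha> r i = R i)
            \<longleftrightarrow> r = rE) \<and>
         (\<forall>r. circle_packing_metric r \<and> (\<forall>i. branched_tanh_curvature_H F \<Phi> \<beta> \<alpha> r i = R i)
            \<longleftrightarrow> r = rH) \<and>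
         solutions_exist_for_all_time (flow_solution_E F \<Phi> \<beta> \<alpha> R) \<and>
         solutions_converge_exponentially (flow_solution_E F \<Phi> \<beta> \<alpha> R) rE \<and>
         solutions_exist_for_all_time (flow_solution_H F \<Phi> \<beta> \<alpha> R) \<and>
         solutions_converge_exponentially (flow_solution_H F \<Phi> \<beta> \<alpha> R) rH"
proof -
  have cos_nonneg: "0 \<le> cos (\<Phi> {i, j})" "0 \<le> cos (\<Phi> {i, l})" "0 \<le> cos (\<Phi> {j, l})"
    if "{i, j, l} \<in> F" "i \<noteq> j" "i \<noteq> l" "j \<noteq> l" for i j l
  proof -
    have "{i, j} \<in> edges F" "{i, l} \<in> edges F" "{j, l} \<in> edges F"
      using that unfolding edges_def by (auto intro!: bexI[OF _ that(1)])
    then show "0 \<le> cos (\<Phi> {i, j})" "0 \<le> cos (\<Phi> {i, l})" "0 \<le> cos (\<Phi> {j, l})"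
      using cos_weight[OF assms(2)] by auto
  qed
  have eqE: "branched_curvature_E F \<Phi> \<beta> \<alpha> r i = R i \<longleftrightarrow>
      R i * exp (\<alpha> * u_E (r $ i)) = K_E F \<Phi> r i + 2 * pi * real (\<beta> i)" and
    powE: "(r $ i) powr \<alpha> = exp (\<alpha> * u_E (r $ i))"
    if "circle_packing_metric r" for r i
  proof -
    have "r $ i > 0"
      using that by (simp add: circle_packing_metric_def)
    then show pow: "(r $ i) powr \<alpha> = exp (\<alpha> * u_E (r $ i))"
      by (simp add: powr_def u_E_def)
    show "branched_curvature_E F \<Phi> \<beta> \<alpha> r i = R i \<longleftrightarrow>
      R i * exp (\<alpha> * u_E (r $ i)) = K_E F \<Phi> r i + 2 * pi * real (\<beta> i)"
      unfolding branched_curvature_E_def pow by (auto simp: divide_eq_eq)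
  qed
  have eqH: "branched_tanh_curvature_H F \<Phi> \<beta> \<alpha> r i = R i \<longleftrightarrow>
      R i * exp (\<alpha> * u_H (r $ i)) = K_H F \<Phi> r i + 2 * pi * real (\<beta> i)" and
    powH: "(tanh (r $ i / 2)) powr \<alpha> = exp (\<alpha> * u_H (r $ i))"
    if "circle_packing_metric r" for r i
  proof -
    have "tanh (r $ i / 2) > 0"
      using that by (simp add: circle_packing_metric_def)
    then show pow: "(tanh (r $ i / 2)) powr \<alpha> = exp (\<alpha> * u_H (r $ i))"
      unfolding powr_def u_H_def by auto
    show "branched_tanh_curvature_H F \<Phi> \<beta> \<alpha> r i = R i \<longleftrightarrow>
      R i * exp (\<alpha> * u_H (r $ i)) = K_H F \<Phi> r i + 2 * pi * real (\<beta> i)"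
      unfolding branched_tanh_curvature_H_def pow by (auto simp: divide_eq_eq)
  qed
  have rE: "circle_packing_metric rE" "\<And>i. branched_curvature_E F \<Phi> \<beta> \<alpha> rE i = R i"
    using assms(7) by (auto simp: admissible_by_E_def)
  have rH: "circle_packing_metric rH" "\<And>i. branched_tanh_curvature_H F \<Phi> \<beta> \<alpha> rH i = R i"
    using assms(8) by (auto simp: tanh_admissible_by_H_def)
  interpret E: branched_packing_flow 0 UNIV exp "\<lambda>_. 1" u_E exp F \<Phi> \<beta> \<alpha> R "\<lambda>r. angle_E (length_E \<Phi> r)" rE
  proof
    show "angle_E (length_E \<Phi> r) i j l = Euc.tri_angle (u_E (r $ i)) (u_E (r $ j)) (u_E (r $ l))
        (cos (\<Phi> {i, j})) (cos (\<Phi> {i, l})) (cos (\<Phi> {j, l}))"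
      if "circle_packing_metric r" "{i, j, l} \<in> F" "i \<noteq> j" "i \<noteq> l" "j \<noteq> l" for r i j l
      using that cos_nonneg by (intro angle_E_eq_tri_angle) auto
    show "R i * exp (\<alpha> * u_E (rE $ i)) = 2 * pi
        - (\<Sum>f\<in>{f \<in> F. i \<in> f}. inner_angle (angle_E (length_E \<Phi> rE)) f i) + 2 * pi * real (\<beta> i)" for i
      using eqE[OF rE(1), of i] rE(2)[of i] by (simp add: K_E_def)
  qed (use assms rE in \<open>auto intro: angle_E_commute\<close>)
  interpret H: branched_packing_flow 1 "{..<0}" xH XH u_H "\<lambda>u. 2 * artanh (exp u)" F \<Phi> \<beta> \<alpha> R
    "\<lambda>r. angle_H (length_H \<Phi> r)" rH
  proof
    show "angle_H (length_H \<Phi> r) i j l = Hyp.tri_angle (u_H (r $ i)) (u_H (r $ j)) (u_H (r $ l))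
        (cos (\<Phi> {i, j})) (cos (\<Phi> {i, l})) (cos (\<Phi> {j, l}))"
      if "circle_packing_metric r" "{i, j, l} \<in> F" "i \<noteq> j" "i \<noteq> l" "j \<noteq> l" for r i j l
      using that cos_nonneg by (intro angle_H_eq_tri_angle) auto
    show "R i * exp (\<alpha> * u_H (rH $ i)) = 2 * pi
        - (\<Sum>f\<in>{f \<in> F. i \<in> f}. inner_angle (angle_H (length_H \<Phi> rH)) f i) + 2 * pi * real (\<beta> i)" for i
      using eqH[OF rH(1), of i] rH(2)[of i] by (simp add: K_H_def)
  qed (use assms rH in \<open>auto intro: angle_H_commute\<close>)
  have KE: "E.K = K_E F \<Phi>" and KH: "H.K = K_H F \<Phi>"
    by (auto simp: fun_eq_iff E.K_def H.K_def K_E_def K_H_def)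
  \<comment> \<open>\<open>powE\<close> needs a positive metric; the congruence rule supplies it
    from the first conjunct of the flow definition.\<close>
  have flowE: "flow_solution_E F \<Phi> \<beta> \<alpha> R = E.sol"
    unfolding fun_eq_iff flow_solution_E_def E.sol_def KE using powE by (simp cong: conj_cong)
  have flowH: "flow_solution_H F \<Phi> \<beta> \<alpha> R = H.sol"
    unfolding fun_eq_iff flow_solution_H_def H.sol_def KH using powH by (simp cong: conj_cong)
  have "circle_packing_metric r \<and> (\<forall>i. branched_curvature_E F \<Phi> \<beta> \<alpha> r i = R i) \<longleftrightarrow> r = rE" for r
    using rE eqE E.metric_unique[of r] unfolding KE by blast
  moreover have "circle_packing_metric r \<and> (\<forall>i. branched_tanh_curvature_H F \<Phi> \<beta> \<alpha> r i = R i) \<longleftrightarrow> r = rH" for r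
    using rH eqH H.metric_unique[of r] unfolding KH by blast
  ultimately show ?thesis
    unfolding flowE flowH
    using E.solutions_exist E.solutions_converge H.solutions_exist H.solutions_converge by blast
qed

end
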